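(* Let $G$ be a compact group. The space $\ell^{p}(\widehat{G})$ is uniformly convex and uniformly smooth for $1<p<\infty$.
   Context: $G$ is a compact group, i.e. a topological group that is compact as a topological space. $\widehat{G}$ is its unitary dual, the set of equivalence classes $[\xi]$ of strongly continuous irreducible unitary representations $\xi:G\to\mathcal{U}(\mathcal{H}_\xi)$. Each representation space $\mathcal{H}_\xi$ is a finite-dimensional complex Hilbert space, and $\dim(\xi):=\dim(\mathcal{H}_\xi)$. $\mathcal{M}(\widehat{G})$ is the space of all mappings $H$ on $\widehat{G}$ with $H([\xi])\in\mathcal{L}(\mathcal{H}_\xi)$ for every $[\xi]\in\widehat{G}$, where $\mathcal{L}(\mathcal{H}_\xi)$ is the algebra of bounded linear operators on $\mathcal{H}_\xi$; one writes $H(\xi)$ for $H([\xi])$. $\|A\|_{\mathcal{S}^2(\mathcal{H}_\xi)}=(\mathrm{Tr}(A^*A))^{1/2}$ is the Hilbert–Schmidt norm. Let $\langle\xi\rangle:=\sqrt{1+\lambda_{[\xi]}^{2}}$, where $\lambda_{[\xi]}$, $[\xi]\in\widehat{G}$, denotes the corresponding eigenvalue of the positive Laplacian (in a bijective manner) indexed by the equivalence class $[\xi]$. The space $S'(\widehat{G})$ of slowly increasing (tempered) distributions on $\widehat{G}$ is the space of all $H\in\mathcal{M}(\widehat{G})$ for which there exists some $k\in\mathbb{N}$ such that $$\sum_{[\xi]\in\widehat{G}}\dim(\xi)\,\langle\xi\rangle^{-k}\,\|H(\xi)\|_{\mathcal{S}^{2}(\mathcal{H}_{\xi})}<\infty.$$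 For $1\le p<\infty$, $\ell^{p}(\widehat{G})$ is the Banach space of all $H\in S'(\widehat{G})$ such that $$\|H\|_{\ell^{p}(\widehat{G})}:=\Big(\sum_{[\xi]\in\widehat{G}}(\dim(\xi))^{p\left(\frac2p-\frac12\right)}\,\|H(\xi)\|_{\mathcal{S}^{2}(\mathcal{H}_{\xi})}^{p}\Big)^{1/p}<\infty.$$ For a Banach space $X$, the modulus of convexity is $\delta_X(\varepsilon)=\inf\{1-\|\frac{x+y}{2}\|: x,y\in X,\ \|x\|=\|y\|=1,\ \|x-y\|=\varepsilon\}$ for $0<\varepsilon\le 2$, and the modulus of smoothness is $\rho_X(t)=\sup\{\frac{\|x+ty\|+\|x-ty\|}{2}-1: x,y\in X,\ \|x\|=\|y\|=1\}$ for $t>0$. $X$ is uniformly convex if $\delta_X(\varepsilon)>0$ for every $\varepsilon>0$ for which $\delta_X(\varepsilon)$ is defined, and uniformly smooth if $\lim_{t\to0}\rho_X(t)/t=0$. *)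

theory Defs
  imports
    "HOL-Analysis.Infinite_Sum"
    "HOL-Analysis.Product_Topology"
    "HOL-Algebra.Module"
    "Jordan_Normal_Form.Schur_Decomposition"
    "Jordan_Normal_Form.VS_Connect"
begin

section \<open>Compact groups and their unitary duals\<close>

locale compact_group = group G for G (structure) +
  fixes T :: "'a topology"
  assumes topspace_eq: "topspace T = carrier G"
    and continuous_mult: "continuous_map (prod_topology T T) T (\<lambda>(x, y). x \<otimes> y)"
    and continuous_inv: "continuous_map T T (\<lambda>x. inv x)"
    and compact: "compact_space T"

text \<open>
  The irreducible unitary representations of a compact group are finite-dimensional, and every
  finite-dimensional complex Hilbert space is isometrically isomorphic to some \<open>\<complex>\<^sup>n\<close>. So the
  representation spaces are taken to be the standard spaces \<open>\<complex>\<^sup>n\<close>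
  (\<^term>\<open>module_vec TYPE(complex) n\<close>, with the standard inner product), and operators on them
  are complex \<open>n \<times> n\<close> matrices. The values of a representation outside \<^term>\<open>carrier G\<close> are
  irrelevant; unitary equivalence ignores them.
\<close>

definition unitary_group :: "nat \<Rightarrow> complex mat monoid" where
  "unitary_group n =
     \<lparr>carrier = {A \<in> carrier_mat n n. mat_adjoint A * A = 1\<^sub>m n \<and> A * mat_adjoint A = 1\<^sub>m n},
      mult = (*), one = 1\<^sub>m n\<rparr>"

text \<open>Norm convergence in \<open>\<complex>\<^sup>n\<close> is convergence of the coordinates, which is how strong continuity
  (continuity of \<open>x \<mapsto> \<xi>(x) v\<close> for every vector \<open>v\<close>) is expressed.\<close>

definition unitary_representation ::
    "('g, 'm) monoid_scheme \<Rightarrow> 'g topology \<Rightarrow> nat \<Rightarrow> ('g \<Rightarrow> complex mat) \<Rightarrow> bool" where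
  "unitary_representation G T n \<xi> \<longleftrightarrow>
     \<xi> \<in> hom G (unitary_group n) \<and>
     (\<forall>v \<in> carrier_vec n. \<forall>i < n. continuous_map T euclidean (\<lambda>x. (\<xi> x *\<^sub>v v) $ i))"

definition irreducible_unitary_representation ::
    "('g, 'm) monoid_scheme \<Rightarrow> 'g topology \<Rightarrow> nat \<Rightarrow> ('g \<Rightarrow> complex mat) \<Rightarrow> bool" where
  "irreducible_unitary_representation G T n \<xi> \<longleftrightarrow>
     unitary_representation G T n \<xi> \<and> n > 0 \<and>
     (\<forall>W. VectorSpace.subspace class_ring W (module_vec TYPE(complex) n) \<and>
          (\<forall>x \<in> carrier G. \<forall>w \<in> W. \<xi> x *\<^sub>v w \<in> W) \<longrightarrow>
          W = {0\<^sub>v n} \<or> W = carrier_vec n)"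

definition rep_dim :: "('g, 'm) monoid_scheme \<Rightarrow> ('g \<Rightarrow> complex mat) \<Rightarrow> nat" where
  "rep_dim G \<xi> = dim_row (\<xi> \<one>\<^bsub>G\<^esub>)"

definition unitary_irreps ::
    "('g, 'm) monoid_scheme \<Rightarrow> 'g topology \<Rightarrow> ('g \<Rightarrow> complex mat) set" where
  "unitary_irreps G T = {\<xi>. irreducible_unitary_representation G T (rep_dim G \<xi>) \<xi>}"

definition unitary_equivalence ::
    "('g, 'm) monoid_scheme \<Rightarrow> 'g topology \<Rightarrow> (('g \<Rightarrow> complex mat) \<times> ('g \<Rightarrow> complex mat)) set" where
  "unitary_equivalence G T =
     {(\<xi>, \<eta>). \<xi> \<in> unitary_irreps G T \<and> \<eta> \<in> unitary_irreps G T \<and> rep_dim G \<xi> = rep_dim G \<eta> \<and>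
        (\<exists>U \<in> carrier (unitary_group (rep_dim G \<xi>)). \<forall>x \<in> carrier G. U * \<xi> x = \<eta> x * U)}"

definition unitary_dual ::
    "('g, 'm) monoid_scheme \<Rightarrow> 'g topology \<Rightarrow> ('g \<Rightarrow> complex mat) set set" where
  "unitary_dual G T = unitary_irreps G T // unitary_equivalence G T"

text \<open>Equivalent representations have the same dimension, so the choice is immaterial.\<close>

definition class_dim :: "('g, 'm) monoid_scheme \<Rightarrow> ('g \<Rightarrow> complex mat) set \<Rightarrow> nat" where
  "class_dim G c = rep_dim G (SOME \<xi>. \<xi> \<in> c)"


section \<open>The Laplacian\<close>

definition matrix_coeff ::
    "('g, 'm) monoid_scheme \<Rightarrow> ('g \<Rightarrow> complex mat) \<Rightarrow> nat \<Rightarrow> nat \<Rightarrow> 'g \<Rightarrow> complex" where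
  "matrix_coeff G \<xi> i j = (\<lambda>x \<in> carrier G. \<xi> x $$ (i, j))"

definition laplacian_eigenvalue_at ::
    "('g, 'm) monoid_scheme \<Rightarrow> (('g \<Rightarrow> complex) \<Rightarrow> 'g \<Rightarrow> complex) \<Rightarrow>
     ('g \<Rightarrow> complex mat) set \<Rightarrow> real \<Rightarrow> bool" where
  "laplacian_eigenvalue_at G L c l \<longleftrightarrow>
     (\<forall>\<xi> \<in> c. \<forall>i < rep_dim G \<xi>. \<forall>j < rep_dim G \<xi>. \<forall>x \<in> carrier G.
        L (matrix_coeff G \<xi> i j) x = complex_of_real l * matrix_coeff G \<xi> i j x)"

text \<open>
  A general compact group carries no canonical Laplacian. What the spaces below use of the
  positive Laplacian is recorded here: it is a linear operator \<open>L\<close> on a space \<open>D\<close> of functions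
  on \<open>G\<close> that contains all matrix coefficients, and the matrix coefficients of a class \<open>[\<xi>]\<close> are
  eigenfunctions for one common eigenvalue \<open>\<lambda>\<^bsub>[\<xi>]\<^esub> \<ge> 0\<close>. For the Laplace--Beltrami operator of a
  bi-invariant metric on a compact Lie group, \<open>D\<close> is for instance the space of smooth functions.
  Distinct classes may share an eigenvalue (on the circle, \<open>n\<close> and \<open>-n\<close> do).
\<close>

definition positive_laplacian ::
    "('g, 'm) monoid_scheme \<Rightarrow> 'g topology \<Rightarrow> ('g \<Rightarrow> complex) set \<Rightarrow>
     (('g \<Rightarrow> complex) \<Rightarrow> 'g \<Rightarrow> complex) \<Rightarrow> bool" where
  "positive_laplacian G T D L \<longleftrightarrow>
     D \<subseteq> extensional (carrier G) \<and>
     (\<forall>\<xi> \<in> unitary_irreps G T. \<forall>i < rep_dim G \<xi>. \<forall>j < rep_dim G \<xi>. matrix_coeff G \<xi> i j \<in> D) \<and>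
     (\<forall>a b. \<forall>f \<in> D. \<forall>g \<in> D. (\<lambda>x \<in> carrier G. a * f x + b * g x) \<in> D \<and>
        (\<forall>x \<in> carrier G. L (\<lambda>x \<in> carrier G. a * f x + b * g x) x = a * L f x + b * L g x)) \<and>
     (\<forall>c \<in> unitary_dual G T. \<exists>l \<ge> 0. laplacian_eigenvalue_at G L c l)"

definition laplacian_eigenvalue ::
    "('g, 'm) monoid_scheme \<Rightarrow> (('g \<Rightarrow> complex) \<Rightarrow> 'g \<Rightarrow> complex) \<Rightarrow>
     ('g \<Rightarrow> complex mat) set \<Rightarrow> real" where
  "laplacian_eigenvalue G L c = (THE l. laplacian_eigenvalue_at G L c l)"

definition bracket ::
    "('g, 'm) monoid_scheme \<Rightarrow> (('g \<Rightarrow> complex) \<Rightarrow> 'g \<Rightarrow> complex) \<Rightarrow>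
     ('g \<Rightarrow> complex mat) set \<Rightarrow> real" where
  "bracket G L c = sqrt (1 + (laplacian_eigenvalue G L c)\<^sup>2)"


section \<open>Normed spaces with an explicit carrier\<close>

record 'v cnormed_space = "(complex, 'v) module" +
  vnorm :: "'v \<Rightarrow> real" (\<open>\<parallel>_\<parallel>\<index>\<close>)

text \<open>\<open>Inf\<close> and \<open>Sup\<close> are those of the reals. In a complex normed space other than \<open>0\<close> both sets
  are nonempty, the first one for all \<open>0 < \<epsilon> \<le> 2\<close>, and they are bounded below by \<open>0\<close> and
  above by \<open>t\<close>, respectively.\<close>

definition modulus_of_convexity :: "('v, 'm) cnormed_space_scheme \<Rightarrow> real \<Rightarrow> real" where
  "modulus_of_convexity X \<epsilon> =
     Inf {1 - \<parallel>(1 / 2) \<odot>\<^bsub>X\<^esub> (x \<oplus>\<^bsub>X\<^esub> y)\<parallel>\<^bsub>X\<^esub> | x y.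
            x \<in> carrier X \<and> y \<in> carrier X \<and> \<parallel>x\<parallel>\<^bsub>X\<^esub> = 1 \<and> \<parallel>y\<parallel>\<^bsub>X\<^esub> = 1 \<and> \<parallel>x \<ominus>\<^bsub>X\<^esub> y\<parallel>\<^bsub>X\<^esub> = \<epsilon>}"

definition modulus_of_smoothness :: "('v, 'm) cnormed_space_scheme \<Rightarrow> real \<Rightarrow> real" where
  "modulus_of_smoothness X t =
     Sup {(\<parallel>x \<oplus>\<^bsub>X\<^esub> complex_of_real t \<odot>\<^bsub>X\<^esub> y\<parallel>\<^bsub>X\<^esub> + \<parallel>x \<ominus>\<^bsub>X\<^esub> complex_of_real t \<odot>\<^bsub>X\<^esub> y\<parallel>\<^bsub>X\<^esub>) / 2 - 1 | x y.
            x \<in> carrier X \<and> y \<in> carrier X \<and> \<parallel>x\<parallel>\<^bsub>X\<^esub> = 1 \<and> \<parallel>y\<parallel>\<^bsub>X\<^esub> = 1}"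

definition uniformly_convex :: "('v, 'm) cnormed_space_scheme \<Rightarrow> bool" where
  "uniformly_convex X \<longleftrightarrow> (\<forall>\<epsilon>. 0 < \<epsilon> \<and> \<epsilon> \<le> 2 \<longrightarrow> modulus_of_convexity X \<epsilon> > 0)"

definition uniformly_smooth :: "('v, 'm) cnormed_space_scheme \<Rightarrow> bool" where
  "uniformly_smooth X \<longleftrightarrow> ((\<lambda>t. modulus_of_smoothness X t / t) \<longlongrightarrow> 0) (at_right 0)"


section \<open>The spaces \<open>\<ell>\<^sup>p\<close> on the unitary dual\<close>

definition hs_norm :: "complex mat \<Rightarrow> real" where
  "hs_norm A = sqrt (Re (\<Sum>i < dim_col A. (mat_adjoint A * A) $$ (i, i)))"

definition dual_mappings ::
    "('g, 'm) monoid_scheme \<Rightarrow> 'g topology \<Rightarrow> (('g \<Rightarrow> complex mat) set \<Rightarrow> complex mat) set" where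
  "dual_mappings G T =
     (\<Pi>\<^sub>E c \<in> unitary_dual G T. carrier_mat (class_dim G c) (class_dim G c))"

definition slowly_increasing ::
    "('g, 'm) monoid_scheme \<Rightarrow> 'g topology \<Rightarrow> (('g \<Rightarrow> complex) \<Rightarrow> 'g \<Rightarrow> complex) \<Rightarrow>
     (('g \<Rightarrow> complex mat) set \<Rightarrow> complex mat) set" where
  "slowly_increasing G T L =
     {H \<in> dual_mappings G T. \<exists>k :: nat.
        (\<lambda>c. real (class_dim G c) * bracket G L c powr (- real k) * hs_norm (H c))
          summable_on unitary_dual G T}"

definition lp_term ::
    "('g, 'm) monoid_scheme \<Rightarrow> real \<Rightarrow> (('g \<Rightarrow> complex mat) set \<Rightarrow> complex mat) \<Rightarrow>
     ('g \<Rightarrow> complex mat) set \<Rightarrow> real" where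
  "lp_term G p H c = real (class_dim G c) powr (p * (2 / p - 1 / 2)) * hs_norm (H c) powr p"

definition lp_dual ::
    "('g, 'm) monoid_scheme \<Rightarrow> 'g topology \<Rightarrow> (('g \<Rightarrow> complex) \<Rightarrow> 'g \<Rightarrow> complex) \<Rightarrow> real \<Rightarrow>
     (('g \<Rightarrow> complex mat) set \<Rightarrow> complex mat) cnormed_space" where
  "lp_dual G T L p =
     \<lparr>carrier = {H \<in> slowly_increasing G T L. lp_term G p H summable_on unitary_dual G T},
      mult = undefined,
      one = undefined,
      zero = (\<lambda>c \<in> unitary_dual G T. 0\<^sub>m (class_dim G c) (class_dim G c)),
      add = (\<lambda>H K. \<lambda>c \<in> unitary_dual G T. H c + K c),
      module.smult = (\<lambda>a H. \<lambda>c \<in> unitary_dual G T. a \<cdot>\<^sub>m H c),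
      vnorm = (\<lambda>H. (\<Sum>\<^sub>\<infinity>c \<in> unitary_dual G T. lp_term G p H c) powr (1 / p))\<rparr>"

end

theory Submission
  imports Defs "HOL-Analysis.Topology_Euclidean_Space"
begin

text \<open>
  The norm of \<open>\<ell>\<^sup>p\<close> on the unitary dual is a weighted \<open>\<ell>\<^sup>p\<close> sum of Hilbert-Schmidt norms,
  \<open>\<parallel>H\<parallel>\<^sup>p = \<Sum>\<^sub>c w(c) \<parallel>H(c)\<parallel>\<^sup>p\<close> with \<open>w(c) \<ge> 0\<close>. Both properties come from inequalities
  between \<open>p\<close>-th powers that hold for each class separately and can be summed over the classes.

  The moduli involve only real combinations of two given elements \<open>x\<close>, \<open>y\<close>. For each class the
  Gram matrix of \<open>x(c)\<close>, \<open>y(c)\<close> in the real inner product \<open>Re Tr(A\<^sup>* B)\<close> is that of a pair of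
  complex numbers \<open>u(c)\<close>, \<open>v(c)\<close>, so that \<open>\<parallel>a x(c) + b y(c)\<parallel> = \<bar>a u(c) + b v(c)\<bar>\<close> for all real
  \<open>a\<close>, \<open>b\<close> (\<open>hs_norm_pair_complex_realization\<close>). The matrices of varying sizes are thereby
  replaced by points of one plane, where compactness is available.

  In a Euclidean space the function \<open>f(x) = \<parallel>x\<parallel>\<^sup>p\<close>, \<open>1 < p\<close>, has two properties:

  \<^item> It is strictly convex. The defect \<open>(f(x) + f(y)) / 2 - f((x + y) / 2)\<close> is positive for
    \<open>x \<noteq> y\<close>, hence bounded away from \<open>0\<close> on the compact set where \<open>f(x) + f(y) = 1\<close> and
    \<open>f(x - y) \<ge> \<eta>\<close>. By homogeneity, for every \<open>\<eta> > 0\<close> there is \<open>K\<close> such that \<open>f(x - y)\<close> is at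
    most \<open>\<eta> (f(x) + f(y))\<close> plus \<open>K\<close> times the defect, for all \<open>x\<close>, \<open>y\<close>
    (\<open>norm_powr_uniformly_convex\<close>).

  \<^item> It is continuously differentiable. Its gradient is uniformly continuous on bounded sets, so
    \<open>(f(x + t y) + f(x - t y)) / 2 \<le> f(x) + \<eta> t (f(x) + f(y))\<close> for all \<open>x\<close>, \<open>y\<close> and all
    small \<open>t \<ge> 0\<close> (\<open>norm_powr_uniformly_smooth\<close>).

  Summing the first estimate over the classes for unit vectors at distance \<open>\<epsilon>\<close> gives
  \<open>\<epsilon>\<^sup>p \<le> 2 \<eta> + K (1 - \<parallel>(x + y) / 2\<parallel>\<^sup>p)\<close>, and \<open>\<eta> = \<epsilon>\<^sup>p / 4\<close> bounds the modulus of
  convexity below. Summing the second gives \<open>\<parallel>x + t y\<parallel>\<^sup>p + \<parallel>x - t y\<parallel>\<^sup>p \<le> 2 + 4 \<eta> t\<close>,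
  so the modulus of smoothness is \<open>o(t)\<close>. In both cases Bernoulli's inequality
  \<open>N\<^sup>p \<ge> 1 + p (N - 1)\<close> returns from \<open>p\<close>-th powers of norms to norms.

  The infimum and the supremum that define the moduli must range over nonempty sets. The class of the
  trivial representation supplies a unit vector \<open>e\<close>; the pair \<open>e\<close>, \<open>\<zeta> e\<close> with \<open>\<bar>\<zeta>\<bar> = 1\<close>
  realizes every distance up to \<open>2\<close>.
\<close>

section \<open>Tangent planes of the \<open>p\<close>-th power of the norm\<close>

lemma powr_above_tangent:
  fixes a b p :: real
  assumes p: "1 < p" and a: "0 \<le> a" and b: "0 \<le> b" and ab: "a \<noteq> b"
  shows "a powr p + p * a powr (p - 1) * (b - a) < b powr p"
proof (cases "a = 0 \<or> b = 0")
  case True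
  then show ?thesis
  proof
    assume "a = 0"
    then show ?thesis using p b ab by simp
  next
    assume b0: "b = 0"
    then have "a powr (p - 1) * a = a powr p"
      using a ab by (simp add: powr_diff)
    then have "p * a powr (p - 1) * (b - a) = - (p * a powr p)"
      using b0 by (simp add: mult.assoc)
    moreover have "a powr p < p * a powr p"
      using p a ab b0 by simp
    moreover have "b powr p = 0" using b0 by simp
    ultimately show ?thesis by linarith
  qed
next
  case False
  then have pos: "0 < a" "0 < b" using a b by auto
  have deriv: "((\<lambda>x. x powr p) has_real_derivative p * x powr (p - 1)) (at x)" if "0 < x" for x
    using that by (auto intro!: derivative_eq_intros)
  consider "a < b" | "b < a" using ab by linarith
  then show ?thesis
  proof cases
    case 1
    obtain z where z: "a < z" "z < b" "b powr p - a powr p = (b - a) * (p * z powr (p - 1))"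
      using MVT2[OF 1, of "\<lambda>x. x powr p" "\<lambda>x. p * x powr (p - 1)"] deriv pos by force
    have "a powr (p - 1) < z powr (p - 1)"
      using z pos p by (intro powr_less_mono2) auto
    then have "(b - a) * (p * a powr (p - 1)) < (b - a) * (p * z powr (p - 1))"
      using 1 p by (intro mult_strict_left_mono) auto
    then show ?thesis using z by (simp add: algebra_simps)
  next
    case 2
    obtain z where z: "b < z" "z < a" "a powr p - b powr p = (a - b) * (p * z powr (p - 1))"
      using MVT2[OF 2, of "\<lambda>x. x powr p" "\<lambda>x. p * x powr (p - 1)"] deriv pos by force
    have "z powr (p - 1) < a powr (p - 1)"
      using z pos p by (intro powr_less_mono2) auto
    then have "(a - b) * (p * z powr (p - 1)) < (a - b) * (p * a powr (p - 1))"
      using 2 p by (intro mult_strict_left_mono) auto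
    then show ?thesis using z by (simp add: algebra_simps)
  qed
qed

lemma powr_ge_Bernoulli:
  fixes N :: real
  assumes "1 < p" "0 \<le> N"
  shows "1 + p * (N - 1) \<le> N powr p"
  using powr_above_tangent[OF assms(1) _ assms(2), of 1] by (cases "N = 1") auto

text \<open>
  The gradient of \<open>\<parallel>x\<parallel>\<^sup>p\<close> for \<open>p > 1\<close>, including the origin, where it vanishes.
\<close>

definition powr_gradient :: "real \<Rightarrow> 'a :: real_inner \<Rightarrow> 'a" where
  "powr_gradient p x = (p * norm x powr (p - 2)) *\<^sub>R x"

text \<open>
  By the Cauchy-Schwarz inequality the tangent plane lies below the tangent line of
  \<open>s \<mapsto> s\<^sup>p\<close> at \<open>s = \<parallel>x\<parallel>\<close>, evaluated at \<open>\<parallel>y\<parallel>\<close>, and that line lies strictly below the curve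
  unless \<open>\<parallel>x\<parallel> = \<parallel>y\<parallel>\<close>. In the latter case Cauchy-Schwarz is strict because \<open>x \<noteq> y\<close>.
\<close>

lemma norm_powr_above_tangent:
  fixes x y :: "'a :: real_inner"
  assumes p: "1 < p" and xy: "x \<noteq> y"
  shows "norm x powr p + inner (powr_gradient p x) (y - x) < norm y powr p"
proof (cases "x = 0")
  case True
  then show ?thesis using xy p by (simp add: powr_gradient_def)
next
  case False
  define c where "c = p * norm x powr (p - 2)"
  have c: "0 < c" using False p by (simp add: c_def)
  have "norm x powr (p - 2) * norm x = norm x powr (p - 1)"
    using False by (simp add: powr_diff power2_eq_square)
  then have cn: "c * norm x = p * norm x powr (p - 1)"
    by (simp add: c_def)
  have inner_eq: "inner (powr_gradient p x) (y - x) = c * (inner x y - norm x * norm x)"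
    by (simp add: powr_gradient_def c_def inner_diff_right dot_square_norm power2_eq_square
        algebra_simps)
  have cs: "inner x y \<le> norm x * norm y" by (rule norm_cauchy_schwarz)
  show ?thesis
  proof (cases "norm x = norm y")
    case True
    have "inner x y \<noteq> norm x * norm y"
      using norm_cauchy_schwarz_eq[of x y] True False xy by auto
    then have "c * (inner x y - norm x * norm x) < 0"
      using cs c True by (simp add: mult_pos_neg)
    then show ?thesis using True inner_eq by simp
  next
    case neq: False
    have "inner (powr_gradient p x) (y - x) \<le> c * (norm x * norm y - norm x * norm x)"
      unfolding inner_eq using c cs by (intro mult_left_mono) auto
    also have "\<dots> = p * norm x powr (p - 1) * (norm y - norm x)"
      unfolding cn[symmetric] by (simp add: algebra_simps)
    finally show ?thesis
      using powr_above_tangent[OF p norm_ge_zero norm_ge_zero neq] by linarith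
  qed
qed

lemma norm_powr_ge_tangent:
  fixes x y :: "'a :: real_inner"
  assumes "1 < p"
  shows "norm x powr p + inner (powr_gradient p x) (y - x) \<le> norm y powr p"
  using norm_powr_above_tangent[OF assms, of x y] by (cases "x = y") auto

text \<open>
  The tangent plane at the midpoint lies below the graph at both ends, and strictly below at one of
  them; in the average the linear terms cancel.
\<close>

lemma norm_powr_midpoint_less:
  fixes x y :: "'a :: real_inner"
  assumes p: "1 < p" and xy: "x \<noteq> y"
  shows "norm ((1 / 2) *\<^sub>R (x + y)) powr p < (norm x powr p + norm y powr p) / 2"
proof -
  define m where "m = (1 / 2) *\<^sub>R (x + y)"
  have mx: "x - m = (1 / 2) *\<^sub>R (x - y)" and my: "y - m = - ((1 / 2) *\<^sub>R (x - y))"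
    by (simp_all add: m_def algebra_simps flip: scaleR_add_left)
  have "m \<noteq> x" using mx xy by auto
  then have "norm m powr p + inner (powr_gradient p m) (x - m) < norm x powr p"
    by (rule norm_powr_above_tangent[OF p])
  moreover have "norm m powr p + inner (powr_gradient p m) (y - m) \<le> norm y powr p"
    by (rule norm_powr_ge_tangent[OF p])
  ultimately show ?thesis
    unfolding mx my m_def[symmetric] inner_minus_right by argo
qed

lemma norm_powr_midpoint_le:
  fixes x y :: "'a :: real_inner"
  assumes "1 < p"
  shows "norm ((1 / 2) *\<^sub>R (x + y)) powr p \<le> (norm x powr p + norm y powr p) / 2"
  using norm_powr_midpoint_less[OF assms, of x y]
  by (cases "x = y") (auto simp flip: scaleR_2)

text \<open>
  This crude bound serves to show summability of the sum of two \<open>p\<close>-summable families.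
\<close>

lemma norm_add_powr_le:
  fixes x y :: "'a :: real_inner"
  assumes p: "1 < p"
  shows "norm (x + y) powr p \<le> 2 powr p * (norm x powr p + norm y powr p)"
proof -
  have "norm (x + y) powr p = 2 powr p * norm ((1 / 2) *\<^sub>R (x + y)) powr p"
    by (simp add: powr_mult powr_divide)
  also have "\<dots> \<le> 2 powr p * ((norm x powr p + norm y powr p) / 2)"
    using norm_powr_midpoint_le[OF p, of x y] by (intro mult_left_mono) auto
  also have "\<dots> \<le> 2 powr p * (norm x powr p + norm y powr p)"
    by (intro mult_left_mono) auto
  finally show ?thesis .
qed

lemma norm_diff_powr_le:
  fixes x y :: "'a :: real_inner"
  assumes p: "1 < p"
  shows "norm (x - y) powr p \<le> 2 powr p * (norm x powr p + norm y powr p)"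
  using norm_add_powr_le[OF p, of x "- y"] by simp

text \<open>
  Only the origin needs an argument: there the norm of the gradient is \<open>p \<parallel>y\<parallel>\<^sup>p\<^sup>-\<^sup>1\<close>, which tends
  to \<open>0\<close> because \<open>p > 1\<close>.
\<close>

lemma continuous_on_powr_gradient:
  fixes S :: "'a :: real_inner set"
  assumes p: "1 < p"
  shows "continuous_on S (powr_gradient p)"
proof -
  have "isCont (powr_gradient p) x" for x :: 'a
  proof (cases "x = 0")
    case False
    then show ?thesis unfolding powr_gradient_def by (intro continuous_intros) auto
  next
    case True
    have "norm (powr_gradient p y) = p * norm y powr (p - 1)" for y :: 'a
      using p by (cases "y = 0") (simp_all add: powr_gradient_def powr_diff power2_eq_square)
    moreover have "((\<lambda>y :: 'a. p * norm y powr (p - 1)) \<longlongrightarrow> p * norm (0 :: 'a) powr (p - 1)) (at 0)"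
      using p by (intro tendsto_mult tendsto_const tendsto_powr' tendsto_norm tendsto_ident_at) auto
    ultimately have "((\<lambda>y :: 'a. powr_gradient p y) \<longlongrightarrow> 0) (at 0)"
      using p by (intro tendsto_norm_zero_cancel[of "powr_gradient p"]) simp
    moreover have "powr_gradient p (0 :: 'a) = 0" by (simp add: powr_gradient_def)
    ultimately show ?thesis using True by (simp add: isCont_def)
  qed
  then show ?thesis by (simp add: continuous_at_imp_continuous_on)
qed

section \<open>Uniform convexity and smoothness of the \<open>p\<close>-th power of the norm\<close>

text \<open>
  Both estimates of this section are homogeneous of degree \<open>p\<close> in the pair \<open>(x, y)\<close>. This
  lemma reduces them to the compact set where \<open>\<parallel>u\<parallel>\<^sup>p + \<parallel>v\<parallel>\<^sup>p = 1\<close>.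
\<close>

lemma normalize_pair:
  fixes x y :: "'a :: real_normed_vector"
  assumes p: "0 < p" and xy: "x \<noteq> 0 \<or> y \<noteq> 0"
  obtains r u v where "0 < r" "x = r *\<^sub>R u" "y = r *\<^sub>R v" "norm u powr p + norm v powr p = 1"
proof -
  define N where "N = norm x powr p + norm y powr p"
  define r where "r = N powr (1 / p)"
  have N: "0 < N"
    using xy by (auto simp: N_def add_pos_nonneg add_nonneg_pos)
  then have r: "0 < r" by (simp add: r_def)
  have rp: "r powr p = N" using N p by (simp add: r_def powr_powr)
  have "norm ((1 / r) *\<^sub>R z) powr p = norm z powr p / N" for z :: 'a
    using r rp by (simp add: powr_divide)
  then have "norm ((1 / r) *\<^sub>R x) powr p + norm ((1 / r) *\<^sub>R y) powr p = 1"
    using N by (simp only: add_divide_distrib[symmetric] N_def[symmetric]) simp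
  then show ?thesis using that[of r "(1 / r) *\<^sub>R x" "(1 / r) *\<^sub>R y"] r by simp
qed

lemma powr_norm_le_1D:
  assumes "0 < p" "norm u powr p + norm v powr p = 1"
  shows "norm u \<le> 1" "norm v \<le> 1"
proof -
  have "z \<le> 1" if "z powr p \<le> 1" "0 \<le> z" for z :: real
    using powr_less_mono2[of p 1 z] that assms(1) by fastforce
  moreover have "norm u powr p \<le> 1" "norm v powr p \<le> 1"
    using assms(2) powr_ge_zero[of "norm u" p] powr_ge_zero[of "norm v" p] by linarith+
  ultimately show "norm u \<le> 1" "norm v \<le> 1" by auto
qed

text \<open>
  On the normalized pairs with \<open>\<parallel>x - y\<parallel>\<^sup>p \<ge> \<eta>\<close> the convexity defect has a positive minimum \<open>\<kappa>\<close>
  by compactness and strict convexity, and \<open>\<parallel>x - y\<parallel>\<^sup>p \<le> 2\<^sup>p\<close>, so that \<open>K = 2\<^sup>p / \<kappa>\<close> works.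
  On the other normalized pairs the first summand suffices.
\<close>

lemma norm_powr_uniformly_convex:
  assumes p: "1 < p" and \<eta>: "0 < \<eta>"
  obtains K where "0 < K"
    "\<And>x y :: 'a :: euclidean_space. norm (x - y) powr p \<le> \<eta> * (norm x powr p + norm y powr p)
       + K * ((norm x powr p + norm y powr p) / 2 - norm ((1 / 2) *\<^sub>R (x + y)) powr p)"
proof -
  define gap :: "'a \<times> 'a \<Rightarrow> real" where
    "gap = (\<lambda>(x, y). (norm x powr p + norm y powr p) / 2 - norm ((1 / 2) *\<^sub>R (x + y)) powr p)"
  define S :: "('a \<times> 'a) set" where
    "S = {(x, y). norm x powr p + norm y powr p = 1 \<and> \<eta> \<le> norm (x - y) powr p}"
  have cont: "continuous_on UNIV (\<lambda>z :: 'a \<times> 'a. norm (f z) powr p)"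
    if "continuous_on UNIV f" for f :: "'a \<times> 'a \<Rightarrow> 'a"
    using p by (intro continuous_on_powr' continuous_intros that) auto
  have "closed S"
    unfolding S_def split_def using p
    by (intro closed_Collect_conj closed_Collect_eq closed_Collect_le continuous_on_add
        continuous_on_const cont continuous_intros)
  moreover have "S \<subseteq> cball 0 1 \<times> cball 0 1"
    using powr_norm_le_1D[of p] p by (force simp: S_def)
  then have "bounded S"
    by (rule bounded_subset[rotated]) (intro bounded_Times bounded_cball)
  ultimately have compact: "compact S" by (simp add: compact_eq_bounded_closed)
  have cont_gap: "continuous_on S gap"
    unfolding gap_def split_def
    by (rule continuous_on_subset[OF _ subset_UNIV], intro continuous_on_diff continuous_on_divide
        continuous_on_add continuous_on_const cont continuous_intros) auto
  obtain \<kappa> where \<kappa>: "0 < \<kappa>" "\<And>z. z \<in> S \<Longrightarrow> \<kappa> \<le> gap z"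
  proof (cases "S = {}")
    case True
    then show ?thesis using that[of 1] by simp
  next
    case False
    then obtain z where z: "z \<in> S" "\<And>z'. z' \<in> S \<Longrightarrow> gap z \<le> gap z'"
      using continuous_attains_inf[OF compact False cont_gap] by auto
    obtain x y where xy: "z = (x, y)" by (cases z)
    then have "x \<noteq> y" using z(1) \<eta> p by (auto simp: S_def)
    then have "0 < gap z"
      using norm_powr_midpoint_less[OF p] xy by (simp add: gap_def)
    then show ?thesis using z that by blast
  qed
  define K where "K = 2 powr p / \<kappa>"
  have K: "0 < K" using \<kappa> by (simp add: K_def)
  have normalized: "norm (x - y) powr p \<le> \<eta> + K * gap (x, y)"
    if 1: "norm x powr p + norm y powr p = 1" for x y :: 'a
  proof (cases "(x, y) \<in> S")
    case True
    have "norm (x - y) powr p \<le> K * \<kappa>"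
      using norm_diff_powr_le[OF p, of x y] 1 \<kappa> by (simp add: K_def)
    also have "\<dots> \<le> K * gap (x, y)" using \<kappa>(2)[OF True] K by simp
    finally show ?thesis using \<eta> by simp
  next
    case False
    moreover have "0 \<le> gap (x, y)"
      using norm_powr_midpoint_le[OF p, of x y] by (simp add: gap_def)
    then have "0 \<le> K * gap (x, y)" using K by simp
    ultimately show ?thesis using 1 by (simp add: S_def)
  qed
  have "norm (x - y) powr p \<le> \<eta> * (norm x powr p + norm y powr p)
       + K * ((norm x powr p + norm y powr p) / 2 - norm ((1 / 2) *\<^sub>R (x + y)) powr p)"
    for x y :: 'a
  proof (cases "x \<noteq> 0 \<or> y \<noteq> 0")
    case False
    then show ?thesis using p by simp
  next
    case True
    obtain r u v where r: "0 < r" and x: "x = r *\<^sub>R u" and y: "y = r *\<^sub>R v"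
      and uv: "norm u powr p + norm v powr p = 1"
      using normalize_pair[OF _ True, of p] p by auto
    have hom: "norm (r *\<^sub>R z) powr p = r powr p * norm z powr p" for z :: 'a
      using r by (simp add: powr_mult)
    have diff: "x - y = r *\<^sub>R (u - v)" and mid: "(1 / 2) *\<^sub>R (x + y) = r *\<^sub>R ((1 / 2) *\<^sub>R (u + v))"
      by (simp_all add: x y algebra_simps)
    have "norm (x - y) powr p = r powr p * norm (u - v) powr p"
      unfolding diff by (rule hom)
    also have "\<dots> \<le> r powr p * (\<eta> + K * gap (u, v))"
      by (intro mult_left_mono normalized uv) simp
    also have "\<dots> = \<eta> * (r powr p * (norm u powr p + norm v powr p)) +
        K * (r powr p * (norm u powr p + norm v powr p) / 2
          - r powr p * norm ((1 / 2) *\<^sub>R (u + v)) powr p)"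
      unfolding uv by (simp add: gap_def uv algebra_simps del: norm_scaleR)
    also have "\<dots> = \<eta> * (norm x powr p + norm y powr p)
       + K * ((norm x powr p + norm y powr p) / 2 - norm ((1 / 2) *\<^sub>R (x + y)) powr p)"
      unfolding mid hom by (simp only: x y hom distrib_left)
    finally show ?thesis .
  qed
  then show ?thesis using that K by blast
qed

text \<open>
  The tangent planes at \<open>x + t y\<close> and at \<open>x - t y\<close> both lie below the graph at \<open>x\<close>. Averaging
  the two inequalities leaves half of \<open>t\<close> times the change of the gradient from \<open>x - t y\<close> to
  \<open>x + t y\<close> in direction \<open>y\<close>, which is small by uniform continuity of the gradient.
\<close>

lemma norm_powr_uniformly_smooth:
  assumes p: "1 < p" and \<eta>: "0 < \<eta>"
  obtains \<tau> where "0 < \<tau>"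
    "\<And>t (x :: 'a :: euclidean_space) y. \<lbrakk>0 \<le> t; t \<le> \<tau>\<rbrakk> \<Longrightarrow>
       (norm (x + t *\<^sub>R y) powr p + norm (x - t *\<^sub>R y) powr p) / 2
         \<le> norm x powr p + \<eta> * t * (norm x powr p + norm y powr p)"
proof -
  let ?J = "powr_gradient p :: 'a \<Rightarrow> 'a"
  have "uniformly_continuous_on (cball 0 2) ?J"
    by (intro compact_uniformly_continuous continuous_on_powr_gradient p compact_cball)
  then obtain \<delta> where \<delta>: "0 < \<delta>"
    "\<And>z z'. \<lbrakk>z \<in> cball 0 2; z' \<in> cball 0 2; dist z' z < \<delta>\<rbrakk> \<Longrightarrow> dist (?J z') (?J z) < \<eta>"
    unfolding uniformly_continuous_on_def using \<eta> by metis
  \<comment> \<open>The two points of tangency have distance at most \<open>2 \<tau> < \<delta>\<close> and stay in the ball of radius \<open>2\<close>.\<close>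
  define \<tau> where "\<tau> = min 1 (\<delta> / 3)"
  have \<tau>: "0 < \<tau>" "\<tau> \<le> 1" "3 * \<tau> \<le> \<delta>" using \<delta> by (auto simp: \<tau>_def min_def)
  have normalized: "(norm (x + t *\<^sub>R y) powr p + norm (x - t *\<^sub>R y) powr p) / 2 \<le> norm x powr p + \<eta> * t"
    if t: "0 \<le> t" "t \<le> \<tau>" and 1: "norm x powr p + norm y powr p = 1" for t and x y :: 'a
  proof -
    have le1: "norm x \<le> 1" "norm y \<le> 1" using powr_norm_le_1D[OF _ 1] p by auto
    have ty: "norm (t *\<^sub>R y) \<le> 1"
      using t \<tau> le1 mult_mono[of t 1 "norm y" 1] by simp
    have ball: "x + t *\<^sub>R y \<in> cball 0 2" "x - t *\<^sub>R y \<in> cball 0 2"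
      using norm_triangle_ineq[of x "t *\<^sub>R y"] norm_triangle_ineq4[of x "t *\<^sub>R y"] le1 ty
      by (auto simp del: norm_scaleR)
    have "dist (x + t *\<^sub>R y) (x - t *\<^sub>R y) = norm ((2 * t) *\<^sub>R y)"
      by (simp add: dist_norm flip: scaleR_2 scaleR_scaleR)
    also have "\<dots> \<le> 2 * \<tau>"
      using t \<tau> mult_mono[OF t(2) le1(2)] by simp
    also have "\<dots> < \<delta>" using \<tau> by linarith
    finally have "norm (?J (x + t *\<^sub>R y) - ?J (x - t *\<^sub>R y)) < \<eta>"
      using \<delta>(2)[OF ball(2,1)] by (simp add: dist_norm)
    then have "norm (?J (x + t *\<^sub>R y) - ?J (x - t *\<^sub>R y)) * norm y \<le> \<eta> * 1"
      using le1 \<eta> by (intro mult_mono) auto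
    then have J: "inner (?J (x + t *\<^sub>R y) - ?J (x - t *\<^sub>R y)) y \<le> \<eta>"
      using norm_cauchy_schwarz[of "?J (x + t *\<^sub>R y) - ?J (x - t *\<^sub>R y)" y] by linarith
    have "norm (x + t *\<^sub>R y) powr p - t * inner (?J (x + t *\<^sub>R y)) y \<le> norm x powr p"
      using norm_powr_ge_tangent[OF p, of "x + t *\<^sub>R y" x] by simp
    moreover have "norm (x - t *\<^sub>R y) powr p + t * inner (?J (x - t *\<^sub>R y)) y \<le> norm x powr p"
      using norm_powr_ge_tangent[OF p, of "x - t *\<^sub>R y" x] by simp
    ultimately have "(norm (x + t *\<^sub>R y) powr p + norm (x - t *\<^sub>R y) powr p) / 2
      \<le> norm x powr p + t * inner (?J (x + t *\<^sub>R y) - ?J (x - t *\<^sub>R y)) y / 2"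
      by (simp add: inner_diff_left field_simps)
    moreover have "t * inner (?J (x + t *\<^sub>R y) - ?J (x - t *\<^sub>R y)) y \<le> t * \<eta>"
      using J t by (intro mult_left_mono) auto
    moreover have "0 \<le> t * \<eta>" using t \<eta> by simp
    ultimately show ?thesis by (simp add: mult.commute)
  qed
  have "(norm (x + t *\<^sub>R y) powr p + norm (x - t *\<^sub>R y) powr p) / 2
         \<le> norm x powr p + \<eta> * t * (norm x powr p + norm y powr p)"
    if t: "0 \<le> t" "t \<le> \<tau>" for t and x y :: 'a
  proof (cases "x \<noteq> 0 \<or> y \<noteq> 0")
    case False
    then show ?thesis using p by simp
  next
    case True
    obtain r u v where r: "0 < r" and x: "x = r *\<^sub>R u" and y: "y = r *\<^sub>R v"
      and uv: "norm u powr p + norm v powr p = 1"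
      using normalize_pair[OF _ True, of p] p by auto
    have hom: "norm (r *\<^sub>R z) powr p = r powr p * norm z powr p" for z :: 'a
      using r by (simp add: powr_mult)
    have plus: "x + t *\<^sub>R y = r *\<^sub>R (u + t *\<^sub>R v)" and minus: "x - t *\<^sub>R y = r *\<^sub>R (u - t *\<^sub>R v)"
      by (simp_all add: x y algebra_simps)
    have "(norm (x + t *\<^sub>R y) powr p + norm (x - t *\<^sub>R y) powr p) / 2
        = r powr p * ((norm (u + t *\<^sub>R v) powr p + norm (u - t *\<^sub>R v) powr p) / 2)"
      unfolding plus minus hom by (simp add: distrib_left)
    also have "\<dots> \<le> r powr p * (norm u powr p + \<eta> * t)"
      by (intro mult_left_mono normalized t uv) simp
    also have "\<dots> = r powr p * norm u powr p
        + \<eta> * t * (r powr p * (norm u powr p + norm v powr p))"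
      unfolding uv by (simp add: algebra_simps)
    also have "\<dots> = norm x powr p + \<eta> * t * (norm x powr p + norm y powr p)"
      by (simp only: x y hom distrib_left)
    finally show ?thesis .
  qed
  then show ?thesis using that \<tau>(1) by blast
qed

section \<open>Weighted \<open>p\<close>-summable families\<close>

lemma summable_weighted_powr_scaleR:
  fixes u :: "'i \<Rightarrow> 'a :: real_normed_vector"
  assumes "(\<lambda>i. w i * norm (u i) powr p) summable_on I"
  shows "(\<lambda>i. w i * norm (a *\<^sub>R u i) powr p) summable_on I"
  using summable_on_cmult_right[OF assms, of "\<bar>a\<bar> powr p"]
  by (simp add: powr_mult mult_ac)

lemma summable_weighted_powr_add:
  fixes u v :: "'i \<Rightarrow> 'a :: real_inner"
  assumes p: "1 < p" and w: "\<And>i. i \<in> I \<Longrightarrow> 0 \<le> w i"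
    and u: "(\<lambda>i. w i * norm (u i) powr p) summable_on I"
    and v: "(\<lambda>i. w i * norm (v i) powr p) summable_on I"
  shows "(\<lambda>i. w i * norm (u i + v i) powr p) summable_on I"
proof (rule summable_on_comparison_test)
  show "(\<lambda>i. 2 powr p * (w i * norm (u i) powr p + w i * norm (v i) powr p)) summable_on I"
    by (intro summable_on_cmult_right summable_on_add u v)
  show "w i * norm (u i + v i) powr p \<le> 2 powr p * (w i * norm (u i) powr p + w i * norm (v i) powr p)"
    if "i \<in> I" for i
    using mult_left_mono[OF norm_add_powr_le[OF p, of "u i" "v i"] w[OF that]]
    by (simp add: algebra_simps)
qed (use w in auto)

text \<open>
  The \<open>\<delta>\<close> depends on \<open>p\<close> and \<open>\<epsilon>\<close> only, as the pointwise estimate is uniform. With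
  \<open>\<eta> = \<epsilon>\<^sup>p / 4\<close> its sum reads \<open>\<epsilon>\<^sup>p \<le> \<epsilon>\<^sup>p / 2 + K (1 - M)\<close>, where \<open>M\<close> is the sum for the
  midpoint.
\<close>

lemma weighted_powr_uniformly_convex:
  assumes p: "1 < p" and \<epsilon>: "0 < \<epsilon>"
  obtains \<delta> where "0 < \<delta>"
    "\<And>(I :: 'i set) w (u :: 'i \<Rightarrow> 'a :: euclidean_space) v.
      \<lbrakk>\<And>i. i \<in> I \<Longrightarrow> 0 \<le> w i;
       (\<lambda>i. w i * norm (u i) powr p) summable_on I; (\<lambda>i. w i * norm (v i) powr p) summable_on I;
       (\<Sum>\<^sub>\<infinity>i\<in>I. w i * norm (u i) powr p) = 1; (\<Sum>\<^sub>\<infinity>i\<in>I. w i * norm (v i) powr p) = 1;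
       (\<Sum>\<^sub>\<infinity>i\<in>I. w i * norm (u i - v i) powr p) = \<epsilon> powr p\<rbrakk>
      \<Longrightarrow> (\<Sum>\<^sub>\<infinity>i\<in>I. w i * norm ((1 / 2) *\<^sub>R (u i + v i)) powr p) \<le> 1 - \<delta>"
proof -
  define \<eta> where "\<eta> = \<epsilon> powr p / 4"
  have \<eta>: "0 < \<eta>" using \<epsilon> by (simp add: \<eta>_def)
  obtain K where K: "0 < K" and bound: "\<And>x y :: 'a. norm (x - y) powr p \<le>
      \<eta> * (norm x powr p + norm y powr p)
       + K * ((norm x powr p + norm y powr p) / 2 - norm ((1 / 2) *\<^sub>R (x + y)) powr p)"
    using norm_powr_uniformly_convex[OF p \<eta>, where ?'a = 'a] by metis
  define \<delta> where "\<delta> = \<epsilon> powr p / (2 * K)"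
  have main: "(\<Sum>\<^sub>\<infinity>i\<in>I. w i * norm ((1 / 2) *\<^sub>R (u i + v i)) powr p) \<le> 1 - \<delta>"
    if w: "\<And>i. i \<in> I \<Longrightarrow> 0 \<le> w i"
      and u: "(\<lambda>i. w i * norm (u i) powr p) summable_on I"
      and v: "(\<lambda>i. w i * norm (v i) powr p) summable_on I"
      and u1: "(\<Sum>\<^sub>\<infinity>i\<in>I. w i * norm (u i) powr p) = 1"
      and v1: "(\<Sum>\<^sub>\<infinity>i\<in>I. w i * norm (v i) powr p) = 1"
      and dist: "(\<Sum>\<^sub>\<infinity>i\<in>I. w i * norm (u i - v i) powr p) = \<epsilon> powr p"
    for I :: "'i set" and w and u v :: "'i \<Rightarrow> 'a"
  proof -
    let ?U = "\<lambda>i. w i * norm (u i) powr p" and ?V = "\<lambda>i. w i * norm (v i) powr p"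
    let ?M = "\<lambda>i. w i * norm ((1 / 2) *\<^sub>R (u i + v i)) powr p"
    have diff: "(\<lambda>i. w i * norm (u i - v i) powr p) summable_on I"
      using summable_weighted_powr_add[OF p w u, of "\<lambda>i. - v i"] v by simp
    have mid: "?M summable_on I"
      by (intro summable_weighted_powr_scaleR summable_weighted_powr_add p w u v)
    have U: "(?U has_sum 1) I" and V: "(?V has_sum 1) I"
      using has_sum_infsum[OF u] has_sum_infsum[OF v] u1 v1 by simp_all
    have upper: "((\<lambda>i. (\<eta> + K / 2) * (?U i + ?V i) + (- K) * ?M i) has_sum
        (\<eta> + K / 2) * (1 + 1) + (- K) * infsum ?M I) I"
      by (intro has_sum_add has_sum_cmult_right has_sum_infsum U V mid)
    have lower: "((\<lambda>i. w i * norm (u i - v i) powr p) has_sum \<epsilon> powr p) I"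
      using has_sum_infsum[OF diff] dist by simp
    have pointwise: "w i * norm (u i - v i) powr p \<le> (\<eta> + K / 2) * (?U i + ?V i) + (- K) * ?M i"
      if "i \<in> I" for i
      using mult_left_mono[OF bound[of "u i" "v i"] w[OF that]] by (simp add: field_simps)
    have "\<epsilon> powr p \<le> (\<eta> + K / 2) * (1 + 1) + (- K) * infsum ?M I"
      by (rule has_sum_mono[OF lower upper pointwise])
    then have "K * infsum ?M I \<le> K - \<epsilon> powr p / 2"
      by (simp add: \<eta>_def algebra_simps)
    then show ?thesis using K by (simp add: \<delta>_def field_simps)
  qed
  have "0 < \<delta>" using \<epsilon> K by (simp add: \<delta>_def)
  from that[OF this main] show ?thesis .
qed

text \<open>
  The sum of twice the pointwise estimate, used with \<open>\<eta> / 4\<close>: for normalized \<open>u\<close>, \<open>v\<close> the error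
  term adds up to \<open>2 \<cdot> (\<eta> / 4) \<cdot> t \<cdot> (1 + 1)\<close>.
\<close>

lemma weighted_powr_uniformly_smooth:
  assumes p: "1 < p" and \<eta>: "0 < \<eta>"
  obtains \<tau> where "0 < \<tau>"
    "\<And>t (I :: 'i set) w (u :: 'i \<Rightarrow> 'a :: euclidean_space) v.
      \<lbrakk>0 \<le> t; t \<le> \<tau>; \<And>i. i \<in> I \<Longrightarrow> 0 \<le> w i;
       (\<lambda>i. w i * norm (u i) powr p) summable_on I; (\<lambda>i. w i * norm (v i) powr p) summable_on I;
       (\<Sum>\<^sub>\<infinity>i\<in>I. w i * norm (u i) powr p) = 1; (\<Sum>\<^sub>\<infinity>i\<in>I. w i * norm (v i) powr p) = 1\<rbrakk>
      \<Longrightarrow> (\<Sum>\<^sub>\<infinity>i\<in>I. w i * norm (u i + t *\<^sub>R v i) powr p)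
          + (\<Sum>\<^sub>\<infinity>i\<in>I. w i * norm (u i - t *\<^sub>R v i) powr p) \<le> 2 + \<eta> * t"
proof -
  have "0 < \<eta> / 4" using \<eta> by simp
  then obtain \<tau> where \<tau>: "0 < \<tau>" and bound: "\<And>t (x :: 'a) y. \<lbrakk>0 \<le> t; t \<le> \<tau>\<rbrakk> \<Longrightarrow>
       (norm (x + t *\<^sub>R y) powr p + norm (x - t *\<^sub>R y) powr p) / 2
         \<le> norm x powr p + \<eta> / 4 * t * (norm x powr p + norm y powr p)"
    using norm_powr_uniformly_smooth[OF p, where ?'a = 'a] by metis
  have main: "(\<Sum>\<^sub>\<infinity>i\<in>I. w i * norm (u i + t *\<^sub>R v i) powr p)
          + (\<Sum>\<^sub>\<infinity>i\<in>I. w i * norm (u i - t *\<^sub>R v i) powr p) \<le> 2 + \<eta> * t"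
    if t: "0 \<le> t" "t \<le> \<tau>"
      and w: "\<And>i. i \<in> I \<Longrightarrow> 0 \<le> w i"
      and u: "(\<lambda>i. w i * norm (u i) powr p) summable_on I"
      and v: "(\<lambda>i. w i * norm (v i) powr p) summable_on I"
      and u1: "(\<Sum>\<^sub>\<infinity>i\<in>I. w i * norm (u i) powr p) = 1"
      and v1: "(\<Sum>\<^sub>\<infinity>i\<in>I. w i * norm (v i) powr p) = 1"
    for t and I :: "'i set" and w and u v :: "'i \<Rightarrow> 'a"
  proof -
    let ?U = "\<lambda>i. w i * norm (u i) powr p" and ?V = "\<lambda>i. w i * norm (v i) powr p"
    let ?P = "\<lambda>i. w i * norm (u i + t *\<^sub>R v i) powr p"
    let ?N = "\<lambda>i. w i * norm (u i - t *\<^sub>R v i) powr p"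
    have plus: "?P summable_on I"
      by (intro summable_weighted_powr_scaleR summable_weighted_powr_add p w u v)
    have minus: "?N summable_on I"
      using summable_weighted_powr_add[OF p w u summable_weighted_powr_scaleR[OF v, of "- t"]]
      by simp
    have U: "(?U has_sum 1) I" and V: "(?V has_sum 1) I"
      using has_sum_infsum[OF u] has_sum_infsum[OF v] u1 v1 by simp_all
    have upper: "((\<lambda>i. 2 * ?U i + \<eta> / 2 * t * (?U i + ?V i)) has_sum 2 * 1 + \<eta> / 2 * t * (1 + 1)) I"
      by (intro has_sum_add has_sum_cmult_right U V)
    have lower: "((\<lambda>i. ?P i + ?N i) has_sum infsum ?P I + infsum ?N I) I"
      by (intro has_sum_add has_sum_infsum plus minus)
    have pointwise: "?P i + ?N i \<le> 2 * ?U i + \<eta> / 2 * t * (?U i + ?V i)" if "i \<in> I" for i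
      using mult_left_mono[OF bound[OF t, of "u i" "v i"] w[OF that]] by (simp add: field_simps)
    have "infsum ?P I + infsum ?N I \<le> 2 * 1 + \<eta> / 2 * t * (1 + 1)"
      by (rule has_sum_mono[OF lower upper pointwise])
    then show ?thesis by simp
  qed
  from that[OF \<tau> main] show ?thesis .
qed

section \<open>The Hilbert-Schmidt norm on a real plane of matrices\<close>

lemma hs_norm_square_sum:
  assumes A: "A \<in> carrier_mat n n"
  shows "hs_norm A = sqrt (\<Sum>i<n. \<Sum>j<n. (cmod (A $$ (j, i)))\<^sup>2)"
proof -
  have "(mat_adjoint A * A) $$ (i, i) = (\<Sum>j<n. complex_of_real ((cmod (A $$ (j, i)))\<^sup>2))"
    if "i < n" for i
  proof -
    have "Matrix.row (mat_adjoint A) i = conjugate (Matrix.col A i)"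
      using A that unfolding mat_adjoint_def by (subst mat_of_rows_row) auto
    moreover have "dim_row (mat_adjoint A) = n"
      using A by (simp add: mat_adjoint_def)
    ultimately have "(mat_adjoint A * A) $$ (i, i) = conjugate (Matrix.col A i) \<bullet> Matrix.col A i"
      using A that by simp
    also have "\<dots> = (\<Sum>j<n. cnj (A $$ (j, i)) * A $$ (j, i))"
      using A that by (simp add: scalar_prod_def lessThan_atLeast0)
    finally show ?thesis by (simp only: complex_norm_square mult.commute)
  qed
  then have "Re (\<Sum>i<n. (mat_adjoint A * A) $$ (i, i)) = (\<Sum>i<n. \<Sum>j<n. (cmod (A $$ (j, i)))\<^sup>2)"
    by simp
  then show ?thesis using A by (simp add: hs_norm_def)
qed

lemma hs_norm_nonneg: "A \<in> carrier_mat n n \<Longrightarrow> 0 \<le> hs_norm A"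
  by (simp add: hs_norm_square_sum sum_nonneg)

lemma hs_norm_smult:
  assumes A: "A \<in> carrier_mat n n"
  shows "hs_norm (a \<cdot>\<^sub>m A) = cmod a * hs_norm A"
proof -
  have "hs_norm (a \<cdot>\<^sub>m A) = sqrt (\<Sum>i<n. \<Sum>j<n. (cmod a)\<^sup>2 * (cmod (A $$ (j, i)))\<^sup>2)"
    using A by (subst hs_norm_square_sum[of _ n]) (auto simp: norm_mult power_mult_distrib)
  also have "\<dots> = sqrt ((cmod a)\<^sup>2 * (\<Sum>i<n. \<Sum>j<n. (cmod (A $$ (j, i)))\<^sup>2))"
    by (simp add: sum_distrib_left)
  finally show ?thesis using hs_norm_square_sum[OF A] by (simp add: real_sqrt_mult)
qed

lemma hs_norm_zero: "hs_norm (0\<^sub>m n n) = 0"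
  by (simp add: hs_norm_square_sum[of _ n])

lemma hs_norm_one_1: "hs_norm (1\<^sub>m 1) = 1"
  by (simp add: hs_norm_square_sum[of _ 1])

text \<open>
  A Cholesky decomposition of the Gram matrix: \<open>u\<close> is placed on the positive real axis with length
  \<open>\<surd>P\<close>, and \<open>v\<close> then has the components \<open>Q / \<surd>P\<close> and \<open>\<surd>(R - Q\<^sup>2 / P)\<close>. The
  condition \<open>Q\<^sup>2 \<le> P R\<close> expresses that the form is nonnegative at \<open>(- Q, P)\<close>. For \<open>P = 0\<close>
  the form is bounded below on the line \<open>b = 1\<close> only if \<open>Q = 0\<close>.
\<close>

lemma semidefinite_form_complex_realization:
  fixes P Q R :: real
  assumes nonneg: "\<And>a b. 0 \<le> a\<^sup>2 * P + 2 * a * b * Q + b\<^sup>2 * R"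
  obtains u v :: complex
    where "\<And>a b. (norm (a *\<^sub>R u + b *\<^sub>R v))\<^sup>2 = a\<^sup>2 * P + 2 * a * b * Q + b\<^sup>2 * R"
proof -
  have P: "0 \<le> P" and R: "0 \<le> R" using nonneg[of 1 0] nonneg[of 0 1] by auto
  show ?thesis
  proof (cases "P = 0")
    case True
    have "Q = 0"
    proof (rule ccontr)
      assume "Q \<noteq> 0"
      \<comment> \<open>The form takes the value \<open>- 1\<close> at this point.\<close>
      then show False using nonneg[of "- (R + 1) / (2 * Q)" 1] True by (simp add: field_simps)
    qed
    then show ?thesis
      using that[of 0 "complex_of_real (sqrt R)"] True R by (simp add: power_mult_distrib)
  next
    case False
    then have P: "0 < P" using P by simp
    have "0 \<le> P * (P * R - Q\<^sup>2)"
      using nonneg[of "- Q" P] by (simp add: algebra_simps power2_eq_square)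
    then have "Q\<^sup>2 \<le> P * R" using P by (simp add: zero_le_mult_iff)
    then have disc: "0 \<le> R - Q\<^sup>2 / P" using P by (simp add: field_simps)
    define v where "v = Complex (Q / sqrt P) (sqrt (R - Q\<^sup>2 / P))"
    have "(norm (a *\<^sub>R complex_of_real (sqrt P) + b *\<^sub>R v))\<^sup>2 = a\<^sup>2 * P + 2 * a * b * Q + b\<^sup>2 * R"
      for a b
    proof -
      have sq: "sqrt P * sqrt P = P" using P by simp
      have "(norm (a *\<^sub>R complex_of_real (sqrt P) + b *\<^sub>R v))\<^sup>2
          = (a * sqrt P + b * (Q / sqrt P))\<^sup>2 + (b * sqrt (R - Q\<^sup>2 / P))\<^sup>2"
        by (simp add: cmod_power2 v_def)
      also have "(b * sqrt (R - Q\<^sup>2 / P))\<^sup>2 = b\<^sup>2 * (R - Q\<^sup>2 / P)"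
        using disc by (simp add: power_mult_distrib)
      also have "(a * sqrt P + b * (Q / sqrt P))\<^sup>2 = a\<^sup>2 * P + 2 * a * b * Q + b\<^sup>2 * (Q\<^sup>2 / P)"
        using P by (simp add: power2_sum power_mult_distrib power_divide)
      finally show ?thesis by (simp add: algebra_simps)
    qed
    then show ?thesis using that by blast
  qed
qed

text \<open>
  The squared Hilbert-Schmidt norm is a sum over the entries, so on the real span of \<open>A\<close> and \<open>B\<close> it is
  a nonnegative quadratic form in the two coefficients.
\<close>

lemma hs_norm_pair_complex_realization:
  assumes A: "A \<in> carrier_mat n n" and B: "B \<in> carrier_mat n n"
  obtains u v :: complex
    where "\<And>a b. hs_norm (complex_of_real a \<cdot>\<^sub>m A + complex_of_real b \<cdot>\<^sub>m B) = norm (a *\<^sub>R u + b *\<^sub>R v)"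
proof -
  define P where "P = (\<Sum>i<n. \<Sum>j<n. (cmod (A $$ (j, i)))\<^sup>2)"
  define Q where "Q = (\<Sum>i<n. \<Sum>j<n. Re (cnj (A $$ (j, i)) * B $$ (j, i)))"
  define R where "R = (\<Sum>i<n. \<Sum>j<n. (cmod (B $$ (j, i)))\<^sup>2)"
  have entry: "(cmod (complex_of_real a * z + complex_of_real b * w))\<^sup>2
      = a\<^sup>2 * (cmod z)\<^sup>2 + 2 * a * b * Re (cnj z * w) + b\<^sup>2 * (cmod w)\<^sup>2" for a b z w
    unfolding cmod_power2 by (simp add: power2_eq_square algebra_simps)
  have form: "hs_norm (complex_of_real a \<cdot>\<^sub>m A + complex_of_real b \<cdot>\<^sub>m B)
      = sqrt (a\<^sup>2 * P + 2 * a * b * Q + b\<^sup>2 * R)"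
    and nonneg: "0 \<le> a\<^sup>2 * P + 2 * a * b * Q + b\<^sup>2 * R" for a b
  proof -
    have sum: "a\<^sup>2 * P + 2 * a * b * Q + b\<^sup>2 * R
      = (\<Sum>i<n. \<Sum>j<n. (cmod (complex_of_real a * A $$ (j, i) + complex_of_real b * B $$ (j, i)))\<^sup>2)"
      unfolding entry P_def Q_def R_def by (simp only: sum.distrib sum_distrib_left)
    then show "0 \<le> a\<^sup>2 * P + 2 * a * b * Q + b\<^sup>2 * R" by (simp add: sum_nonneg)
    have "complex_of_real a \<cdot>\<^sub>m A + complex_of_real b \<cdot>\<^sub>m B \<in> carrier_mat n n" using A B by simp
    then show "hs_norm (complex_of_real a \<cdot>\<^sub>m A + complex_of_real b \<cdot>\<^sub>m B)
        = sqrt (a\<^sup>2 * P + 2 * a * b * Q + b\<^sup>2 * R)"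
      unfolding sum using A B by (subst hs_norm_square_sum) auto
  qed
  obtain u v :: complex
    where "\<And>a b. (norm (a *\<^sub>R u + b *\<^sub>R v))\<^sup>2 = a\<^sup>2 * P + 2 * a * b * Q + b\<^sup>2 * R"
    using semidefinite_form_complex_realization nonneg by blast
  then have "hs_norm (complex_of_real a \<cdot>\<^sub>m A + complex_of_real b \<cdot>\<^sub>m B) = norm (a *\<^sub>R u + b *\<^sub>R v)" for a b
    unfolding form by (metis norm_ge_zero real_sqrt_abs abs_of_nonneg)
  then show ?thesis using that by blast
qed

section \<open>The operations and the norm of \<open>\<ell>\<^sup>p\<close> on the unitary dual\<close>

lemma lp_dual_value:
  "H \<in> carrier (lp_dual G T L p) \<Longrightarrow> c \<in> unitary_dual G T \<Longrightarrow>
    H c \<in> carrier_mat (class_dim G c) (class_dim G c)"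
  by (auto simp: lp_dual_def slowly_increasing_def dual_mappings_def)

lemma lp_dual_vnorm_nonneg: "0 \<le> \<parallel>H\<parallel>\<^bsub>lp_dual G T L p\<^esub>"
  by (simp add: lp_dual_def)

lemma lp_dual_smult:
  assumes H: "H \<in> carrier (lp_dual G T L p)" and p: "0 < p"
  shows "a \<odot>\<^bsub>lp_dual G T L p\<^esub> H \<in> carrier (lp_dual G T L p)"
    and "\<parallel>a \<odot>\<^bsub>lp_dual G T L p\<^esub> H\<parallel>\<^bsub>lp_dual G T L p\<^esub> = cmod a * \<parallel>H\<parallel>\<^bsub>lp_dual G T L p\<^esub>"
proof -
  let ?\<Gamma> = "unitary_dual G T" and ?K = "\<lambda>c \<in> unitary_dual G T. a \<cdot>\<^sub>m H c"
  have hs: "hs_norm (?K c) = cmod a * hs_norm (H c)" if "c \<in> ?\<Gamma>" for c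
    using that hs_norm_smult[OF lp_dual_value[OF H that]] by simp
  have lp: "lp_term G p ?K c = cmod a powr p * lp_term G p H c" if "c \<in> ?\<Gamma>" for c
    unfolding lp_term_def hs[OF that] using hs_norm_nonneg[OF lp_dual_value[OF H that]]
    by (simp add: powr_mult)
  have mem: "?K \<in> dual_mappings G T"
    using lp_dual_value[OF H] by (auto simp: dual_mappings_def)
  obtain k where "(\<lambda>c. real (class_dim G c) * bracket G L c powr (- real k) * hs_norm (H c))
      summable_on ?\<Gamma>"
    using H by (auto simp: lp_dual_def slowly_increasing_def)
  from summable_on_cmult_right[OF this, of "cmod a"]
  have "(\<lambda>c. real (class_dim G c) * bracket G L c powr (- real k) * hs_norm (?K c)) summable_on ?\<Gamma>"
    by (rule summable_on_cong[THEN iffD1, rotated]) (simp add: hs del: restrict_apply)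
  then have slow: "?K \<in> slowly_increasing G T L"
    using mem unfolding slowly_increasing_def by blast
  have "lp_term G p H summable_on ?\<Gamma>" using H by (simp add: lp_dual_def)
  from summable_on_cmult_right[OF this, of "cmod a powr p"]
  have "lp_term G p ?K summable_on ?\<Gamma>"
    by (rule summable_on_cong[THEN iffD1, rotated]) (simp add: lp)
  then show "a \<odot>\<^bsub>lp_dual G T L p\<^esub> H \<in> carrier (lp_dual G T L p)"
    using slow by (simp add: lp_dual_def)
  have "infsum (lp_term G p ?K) ?\<Gamma> = cmod a powr p * infsum (lp_term G p H) ?\<Gamma>"
    unfolding infsum_cmult_right'[symmetric] by (rule infsum_cong) (rule lp)
  moreover have "0 \<le> infsum (lp_term G p H) ?\<Gamma>"
    by (rule infsum_nonneg) (simp add: lp_term_def)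
  ultimately show "\<parallel>a \<odot>\<^bsub>lp_dual G T L p\<^esub> H\<parallel>\<^bsub>lp_dual G T L p\<^esub> = cmod a * \<parallel>H\<parallel>\<^bsub>lp_dual G T L p\<^esub>"
    using p by (simp add: lp_dual_def powr_mult powr_powr)
qed

text \<open>
  Subtraction is addition of the additive inverse, which is the unique carrier element that adds up to
  zero. It is \<open>(- 1) \<odot> H\<close>, and uniqueness holds because carrier elements are determined by their
  values on the unitary dual.
\<close>

lemma lp_dual_minus:
  assumes H: "H \<in> carrier (lp_dual G T L p)" and p: "0 < p"
  shows "K \<ominus>\<^bsub>lp_dual G T L p\<^esub> H = (\<lambda>c \<in> unitary_dual G T. K c + (- 1) \<cdot>\<^sub>m H c)"
proof -
  let ?X = "lp_dual G T L p"
  have "\<ominus>\<^bsub>?X\<^esub> H = (- 1) \<odot>\<^bsub>?X\<^esub> H"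
    unfolding a_inv_def m_inv_def
  proof (rule the_equality)
    have "H c + (- 1) \<cdot>\<^sub>m H c = 0\<^sub>m (class_dim G c) (class_dim G c)"
      "(- 1) \<cdot>\<^sub>m H c + H c = 0\<^sub>m (class_dim G c) (class_dim G c)" if "c \<in> unitary_dual G T" for c
      using lp_dual_value[OF H that] by auto
    then show "(- 1) \<odot>\<^bsub>?X\<^esub> H \<in> carrier (add_monoid ?X) \<and>
        H \<otimes>\<^bsub>add_monoid ?X\<^esub> ((- 1) \<odot>\<^bsub>?X\<^esub> H) = \<one>\<^bsub>add_monoid ?X\<^esub> \<and>
        ((- 1) \<odot>\<^bsub>?X\<^esub> H) \<otimes>\<^bsub>add_monoid ?X\<^esub> H = \<one>\<^bsub>add_monoid ?X\<^esub>"
      using lp_dual_smult(1)[OF H p, of "- 1"] by (auto simp: lp_dual_def intro!: restrict_ext)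
  next
    fix J assume J: "J \<in> carrier (add_monoid ?X) \<and> H \<otimes>\<^bsub>add_monoid ?X\<^esub> J = \<one>\<^bsub>add_monoid ?X\<^esub> \<and>
        J \<otimes>\<^bsub>add_monoid ?X\<^esub> H = \<one>\<^bsub>add_monoid ?X\<^esub>"
    then have J_carrier: "J \<in> carrier ?X" by simp
    have "J c = (- 1) \<cdot>\<^sub>m H c" if c: "c \<in> unitary_dual G T" for c
    proof -
      let ?n = "class_dim G c"
      have "(\<lambda>c \<in> unitary_dual G T. H c + J c) c = (\<lambda>c \<in> unitary_dual G T. 0\<^sub>m (class_dim G c) (class_dim G c)) c"
        using J by (simp add: lp_dual_def)
      then have sum: "H c + J c = 0\<^sub>m ?n ?n" using c by simp
      have Hc: "H c \<in> carrier_mat ?n ?n" and Jc: "J c \<in> carrier_mat ?n ?n"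
        using lp_dual_value c H J_carrier by blast+
      show ?thesis
      proof (rule eq_matI)
        fix i j assume ij: "i < dim_row ((- 1) \<cdot>\<^sub>m H c)" "j < dim_col ((- 1) \<cdot>\<^sub>m H c)"
        then have "(H c + J c) $$ (i, j) = 0" using sum Hc by simp
        then show "J c $$ (i, j) = ((- 1) \<cdot>\<^sub>m H c) $$ (i, j)"
          using ij Hc Jc by (simp add: add_eq_0_iff)
      qed (use Hc Jc in auto)
    qed
    moreover have "J \<in> extensional (unitary_dual G T)"
      using J_carrier by (auto simp: lp_dual_def slowly_increasing_def dual_mappings_def PiE_def)
    ultimately show "J = (- 1) \<odot>\<^bsub>?X\<^esub> H"
      by (auto simp: lp_dual_def extensional_def fun_eq_iff)
  qed
  then show ?thesis
    by (auto simp: a_minus_def lp_dual_def intro!: restrict_ext)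
qed

definition lp_weight :: "('g, 'm) monoid_scheme \<Rightarrow> real \<Rightarrow> ('g \<Rightarrow> complex mat) set \<Rightarrow> real" where
  "lp_weight G p c = real (class_dim G c) powr (p * (2 / p - 1 / 2))"

lemma lp_weight_nonneg: "0 \<le> lp_weight G p c"
  by (simp add: lp_weight_def)

lemma lp_dual_vnorm_powr:
  assumes p: "0 < p"
    and F: "\<And>c. c \<in> unitary_dual G T \<Longrightarrow> hs_norm (F c) = norm (z c)"
  shows "\<parallel>F\<parallel>\<^bsub>lp_dual G T L p\<^esub> powr p
    = (\<Sum>\<^sub>\<infinity>c\<in>unitary_dual G T. lp_weight G p c * norm (z c) powr p)"
proof -
  have "0 \<le> infsum (lp_term G p F) (unitary_dual G T)"
    by (rule infsum_nonneg) (simp add: lp_term_def)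
  then have "\<parallel>F\<parallel>\<^bsub>lp_dual G T L p\<^esub> powr p = infsum (lp_term G p F) (unitary_dual G T)"
    using p by (simp add: lp_dual_def powr_powr)
  also have "\<dots> = (\<Sum>\<^sub>\<infinity>c\<in>unitary_dual G T. lp_weight G p c * norm (z c) powr p)"
    by (rule infsum_cong) (simp add: lp_term_def lp_weight_def F)
  finally show ?thesis .
qed

lemma lp_dual_summable:
  assumes H: "H \<in> carrier (lp_dual G T L p)"
    and z: "\<And>c. c \<in> unitary_dual G T \<Longrightarrow> hs_norm (H c) = norm (z c)"
  shows "(\<lambda>c. lp_weight G p c * norm (z c) powr p) summable_on unitary_dual G T"
proof -
  have "lp_term G p H summable_on unitary_dual G T" using H by (simp add: lp_dual_def)
  then show ?thesis
    by (rule summable_on_cong[THEN iffD1, rotated]) (simp add: lp_term_def lp_weight_def z)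
qed

text \<open>
  Every norm that occurs in one of the two moduli is a weighted \<open>p\<close>-norm of the same real combination
  of the complex families \<open>u\<close> and \<open>v\<close>.
\<close>

lemma lp_dual_pair_complex_realization:
  assumes p: "0 < p"
    and H: "H \<in> carrier (lp_dual G T L p)" and K: "K \<in> carrier (lp_dual G T L p)"
  obtains u v :: "('g \<Rightarrow> complex mat) set \<Rightarrow> complex" where
    "(\<lambda>c. lp_weight G p c * norm (u c) powr p) summable_on unitary_dual G T"
    "(\<lambda>c. lp_weight G p c * norm (v c) powr p) summable_on unitary_dual G T"
    "\<parallel>H\<parallel>\<^bsub>lp_dual G T L p\<^esub> powr p = (\<Sum>\<^sub>\<infinity>c\<in>unitary_dual G T. lp_weight G p c * norm (u c) powr p)"
    "\<parallel>K\<parallel>\<^bsub>lp_dual G T L p\<^esub> powr p = (\<Sum>\<^sub>\<infinity>c\<in>unitary_dual G T. lp_weight G p c * norm (v c) powr p)"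
    "\<parallel>H \<ominus>\<^bsub>lp_dual G T L p\<^esub> K\<parallel>\<^bsub>lp_dual G T L p\<^esub> powr p
      = (\<Sum>\<^sub>\<infinity>c\<in>unitary_dual G T. lp_weight G p c * norm (u c - v c) powr p)"
    "\<parallel>(1 / 2) \<odot>\<^bsub>lp_dual G T L p\<^esub> (H \<oplus>\<^bsub>lp_dual G T L p\<^esub> K)\<parallel>\<^bsub>lp_dual G T L p\<^esub> powr p
      = (\<Sum>\<^sub>\<infinity>c\<in>unitary_dual G T. lp_weight G p c * norm ((1 / 2) *\<^sub>R (u c + v c)) powr p)"
    "\<parallel>H \<oplus>\<^bsub>lp_dual G T L p\<^esub> complex_of_real t \<odot>\<^bsub>lp_dual G T L p\<^esub> K\<parallel>\<^bsub>lp_dual G T L p\<^esub> powr p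
      = (\<Sum>\<^sub>\<infinity>c\<in>unitary_dual G T. lp_weight G p c * norm (u c + t *\<^sub>R v c) powr p)"
    "\<parallel>H \<ominus>\<^bsub>lp_dual G T L p\<^esub> complex_of_real t \<odot>\<^bsub>lp_dual G T L p\<^esub> K\<parallel>\<^bsub>lp_dual G T L p\<^esub> powr p
      = (\<Sum>\<^sub>\<infinity>c\<in>unitary_dual G T. lp_weight G p c * norm (u c - t *\<^sub>R v c) powr p)"
proof -
  let ?X = "lp_dual G T L p" and ?\<Gamma> = "unitary_dual G T"
  have "\<exists>u v :: complex. \<forall>a b.
      hs_norm (complex_of_real a \<cdot>\<^sub>m H c + complex_of_real b \<cdot>\<^sub>m K c) = norm (a *\<^sub>R u + b *\<^sub>R v)"
    if "c \<in> ?\<Gamma>" for c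
    using hs_norm_pair_complex_realization[OF lp_dual_value[OF H that] lp_dual_value[OF K that]]
    by metis
  then obtain u v :: "('g \<Rightarrow> complex mat) set \<Rightarrow> complex" where uv: "\<And>c a b. c \<in> ?\<Gamma> \<Longrightarrow>
      hs_norm (complex_of_real a \<cdot>\<^sub>m H c + complex_of_real b \<cdot>\<^sub>m K c) = norm (a *\<^sub>R u c + b *\<^sub>R v c)"
    by metis
  note val = lp_dual_value[OF H] lp_dual_value[OF K]
  have H_hs: "hs_norm (H c) = norm (u c)" and K_hs: "hs_norm (K c) = norm (v c)" if "c \<in> ?\<Gamma>" for c
  proof -
    have "complex_of_real 1 \<cdot>\<^sub>m H c + complex_of_real 0 \<cdot>\<^sub>m K c = H c"
      "complex_of_real 0 \<cdot>\<^sub>m H c + complex_of_real 1 \<cdot>\<^sub>m K c = K c"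
      using val[OF that] by auto
    then show "hs_norm (H c) = norm (u c)" "hs_norm (K c) = norm (v c)"
      using uv[OF that, of 1 0] uv[OF that, of 0 1] by simp_all
  qed
  have diff_hs: "hs_norm (H c + (- 1) \<cdot>\<^sub>m K c) = norm (u c - v c)" if "c \<in> ?\<Gamma>" for c
  proof -
    have "complex_of_real 1 \<cdot>\<^sub>m H c + complex_of_real (- 1) \<cdot>\<^sub>m K c = H c + (- 1) \<cdot>\<^sub>m K c"
      using val[OF that] by auto
    then show ?thesis using uv[OF that, of 1 "- 1"] by simp
  qed
  have mid_hs: "hs_norm ((1 / 2) \<cdot>\<^sub>m (H c + K c)) = norm ((1 / 2) *\<^sub>R (u c + v c))" if "c \<in> ?\<Gamma>" for c
  proof -
    have "complex_of_real (1 / 2) \<cdot>\<^sub>m H c + complex_of_real (1 / 2) \<cdot>\<^sub>m K c = (1 / 2) \<cdot>\<^sub>m (H c + K c)"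
      using val[OF that] by (intro eq_matI) (auto simp: algebra_simps)
    then show ?thesis using uv[OF that, of "1 / 2" "1 / 2"] by (simp only: scaleR_add_right)
  qed
  have plus_hs: "hs_norm (H c + complex_of_real t \<cdot>\<^sub>m K c) = norm (u c + t *\<^sub>R v c)"
    and minus_hs: "hs_norm (H c + (- 1) \<cdot>\<^sub>m (complex_of_real t \<cdot>\<^sub>m K c)) = norm (u c - t *\<^sub>R v c)"
    if "c \<in> ?\<Gamma>" for c
  proof -
    have "complex_of_real 1 \<cdot>\<^sub>m H c + complex_of_real t \<cdot>\<^sub>m K c = H c + complex_of_real t \<cdot>\<^sub>m K c"
      "complex_of_real 1 \<cdot>\<^sub>m H c + complex_of_real (- t) \<cdot>\<^sub>m K c
        = H c + (- 1) \<cdot>\<^sub>m (complex_of_real t \<cdot>\<^sub>m K c)"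
      using val[OF that] by (auto intro!: eq_matI)
    then show "hs_norm (H c + complex_of_real t \<cdot>\<^sub>m K c) = norm (u c + t *\<^sub>R v c)"
      "hs_norm (H c + (- 1) \<cdot>\<^sub>m (complex_of_real t \<cdot>\<^sub>m K c)) = norm (u c - t *\<^sub>R v c)"
      using uv[OF that, of 1 t] uv[OF that, of 1 "- t"] by simp_all
  qed
  note tK = lp_dual_smult(1)[OF K p]
  show ?thesis
  proof (rule that[of u v])
    show "(\<lambda>c. lp_weight G p c * norm (u c) powr p) summable_on ?\<Gamma>"
      by (rule lp_dual_summable[OF H H_hs])
    show "(\<lambda>c. lp_weight G p c * norm (v c) powr p) summable_on ?\<Gamma>"
      by (rule lp_dual_summable[OF K K_hs])
    show "\<parallel>H\<parallel>\<^bsub>?X\<^esub> powr p = (\<Sum>\<^sub>\<infinity>c\<in>?\<Gamma>. lp_weight G p c * norm (u c) powr p)"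
      by (rule lp_dual_vnorm_powr[OF p H_hs])
    show "\<parallel>K\<parallel>\<^bsub>?X\<^esub> powr p = (\<Sum>\<^sub>\<infinity>c\<in>?\<Gamma>. lp_weight G p c * norm (v c) powr p)"
      by (rule lp_dual_vnorm_powr[OF p K_hs])
    show "\<parallel>H \<ominus>\<^bsub>?X\<^esub> K\<parallel>\<^bsub>?X\<^esub> powr p = (\<Sum>\<^sub>\<infinity>c\<in>?\<Gamma>. lp_weight G p c * norm (u c - v c) powr p)"
      unfolding lp_dual_minus[OF K p] by (rule lp_dual_vnorm_powr[OF p]) (simp add: diff_hs)
    show "\<parallel>(1 / 2) \<odot>\<^bsub>?X\<^esub> (H \<oplus>\<^bsub>?X\<^esub> K)\<parallel>\<^bsub>?X\<^esub> powr p
      = (\<Sum>\<^sub>\<infinity>c\<in>?\<Gamma>. lp_weight G p c * norm ((1 / 2) *\<^sub>R (u c + v c)) powr p)"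
      by (rule lp_dual_vnorm_powr[OF p]) (simp add: lp_dual_def mid_hs del: norm_scaleR)
    show "\<parallel>H \<oplus>\<^bsub>?X\<^esub> complex_of_real t \<odot>\<^bsub>?X\<^esub> K\<parallel>\<^bsub>?X\<^esub> powr p
      = (\<Sum>\<^sub>\<infinity>c\<in>?\<Gamma>. lp_weight G p c * norm (u c + t *\<^sub>R v c) powr p)"
      by (rule lp_dual_vnorm_powr[OF p]) (simp add: lp_dual_def plus_hs)
    show "\<parallel>H \<ominus>\<^bsub>?X\<^esub> complex_of_real t \<odot>\<^bsub>?X\<^esub> K\<parallel>\<^bsub>?X\<^esub> powr p
      = (\<Sum>\<^sub>\<infinity>c\<in>?\<Gamma>. lp_weight G p c * norm (u c - t *\<^sub>R v c) powr p)"
      unfolding lp_dual_minus[OF tK p]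
      by (rule lp_dual_vnorm_powr[OF p]) (simp add: lp_dual_def minus_hs)
  qed
qed

section \<open>A unit vector and vectors at a given distance\<close>

lemma mat_adjoint_one_1: "mat_adjoint (1\<^sub>m 1 :: complex mat) = 1\<^sub>m 1"
  by (rule eq_matI) (auto simp: mat_adjoint_def mat_of_rows_def)

lemma trivial_representation_irrep: "(\<lambda>_. 1\<^sub>m 1) \<in> unitary_irreps G T"
proof -
  have "unitary_representation G T 1 (\<lambda>_. 1\<^sub>m 1)"
    by (auto simp: unitary_representation_def hom_def unitary_group_def mat_adjoint_one_1[simplified])
  moreover have "W = {0\<^sub>v 1} \<or> W = carrier_vec 1"
    if "VectorSpace.subspace class_ring W (module_vec TYPE(complex) 1)" for W
  proof -
    have sub: "submodule class_ring W (module_vec TYPE(complex) 1)"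
      using that by (simp add: VectorSpace.subspace_def)
    have smult: "a \<cdot>\<^sub>v w \<in> W" if "w \<in> W" for a w
      using submodule.smult_closed[OF sub _ that, of a] by (simp add: module_vec_simps)
    have zero: "0\<^sub>v 1 \<in> W"
      using submodule.zero_closed[OF sub] by (simp add: module_vec_simps)
    have W: "W \<subseteq> carrier_vec 1"
      using submodule.subset[OF sub] by (simp add: module_vec_simps)
    show ?thesis
    proof (cases "W \<subseteq> {0\<^sub>v 1}")
      case True
      then show ?thesis using zero by auto
    next
      case False
      then obtain w where w: "w \<in> W" "w \<noteq> 0\<^sub>v 1" by auto
      then have "w \<in> carrier_vec 1" using W by auto
      then have w0: "w $ 0 \<noteq> 0" using eq_vecI[of w "0\<^sub>v 1"] w by auto
      have "v \<in> W" if "v \<in> carrier_vec 1" for v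
      proof -
        have "v = (v $ 0 / w $ 0) \<cdot>\<^sub>v w"
          using that \<open>w \<in> carrier_vec 1\<close> w0 by (intro eq_vecI) auto
        then show ?thesis using smult[OF w(1)] by metis
      qed
      then show ?thesis using W by auto
    qed
  qed
  ultimately show ?thesis
    by (simp add: unitary_irreps_def irreducible_unitary_representation_def rep_dim_def)
qed

text \<open>
  The class of the trivial representation. The dimension of a class is that of an arbitrary member, and
  equivalent representations have equal dimension.
\<close>

lemma trivial_class:
  obtains c where "c \<in> unitary_dual G T" "class_dim G c = 1"
proof -
  define \<iota> where "\<iota> = (\<lambda>_ :: 'a. 1\<^sub>m 1 :: complex mat)"
  define c where "c = unitary_equivalence G T `` {\<iota>}"
  have \<iota>: "\<iota> \<in> unitary_irreps G T"
    unfolding \<iota>_def by (rule trivial_representation_irrep)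
  have dim: "rep_dim G \<iota> = 1" by (simp add: rep_dim_def \<iota>_def)
  have "1\<^sub>m 1 \<in> carrier (unitary_group (rep_dim G \<iota>))"
    unfolding dim by (simp add: unitary_group_def mat_adjoint_one_1[simplified])
  then have "\<exists>U \<in> carrier (unitary_group (rep_dim G \<iota>)). \<forall>x \<in> carrier G. U * \<iota> x = \<iota> x * U"
    by (intro bexI[of _ "1\<^sub>m 1"]) (simp_all add: \<iota>_def)
  then have "(\<iota>, \<iota>) \<in> unitary_equivalence G T"
    using \<iota> by (simp add: unitary_equivalence_def)
  then have "\<iota> \<in> c" by (simp add: c_def)
  then have "(SOME \<xi>. \<xi> \<in> c) \<in> c" by (rule someI[of "\<lambda>\<xi>. \<xi> \<in> c"])
  then have "class_dim G c = 1"
    using dim by (auto simp: class_dim_def c_def unitary_equivalence_def)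
  moreover have "c \<in> unitary_dual G T"
    unfolding unitary_dual_def c_def by (rule quotientI[OF \<iota>])
  ultimately show ?thesis using that by blast
qed

text \<open>
  The identity operator at a one-dimensional class and \<open>0\<close> elsewhere. All sums over the dual then
  reduce to one term, in particular the one that controls the growth of a tempered distribution.
\<close>

lemma lp_dual_unit_vector:
  assumes p: "0 < p"
  obtains e where "e \<in> carrier (lp_dual G T L p)" "\<parallel>e\<parallel>\<^bsub>lp_dual G T L p\<^esub> = 1"
proof -
  let ?\<Gamma> = "unitary_dual G T"
  obtain c0 where c0: "c0 \<in> ?\<Gamma>" "class_dim G c0 = 1" using trivial_class .
  define e where "e = (\<lambda>c \<in> ?\<Gamma>. if c = c0 then 1\<^sub>m 1 else 0\<^sub>m (class_dim G c) (class_dim G c) :: complex mat)"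
  have hs: "hs_norm (e c) = (if c = c0 then 1 else 0)" if "c \<in> ?\<Gamma>" for c
    using that hs_norm_one_1 by (simp add: e_def hs_norm_zero)
  have sum: "(f has_sum f c0) ?\<Gamma>" if "\<And>c. c \<in> ?\<Gamma> \<Longrightarrow> c \<noteq> c0 \<Longrightarrow> f c = 0"
    for f :: "_ \<Rightarrow> real"
    using has_sum_finite[of "{c0}" f] has_sum_cong_neutral[of ?\<Gamma> "{c0}" f f] that c0 by auto
  have lp: "lp_term G p e c = (if c = c0 then 1 else 0)" if "c \<in> ?\<Gamma>" for c
    using hs[OF that] c0 by (simp add: lp_term_def)
  have lp_sum: "(lp_term G p e has_sum 1) ?\<Gamma>"
    using sum[of "lp_term G p e"] lp c0 by simp
  have "((\<lambda>c. real (class_dim G c) * bracket G L c powr (- real 0) * hs_norm (e c)) summable_on ?\<Gamma>)"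
    by (rule has_sum_imp_summable, rule sum) (simp add: hs)
  moreover have "e \<in> dual_mappings G T"
    using c0 by (auto simp: dual_mappings_def e_def)
  ultimately have "e \<in> slowly_increasing G T L"
    unfolding slowly_increasing_def by blast
  then have "e \<in> carrier (lp_dual G T L p)"
    using has_sum_imp_summable[OF lp_sum] by (simp add: lp_dual_def)
  moreover have "\<parallel>e\<parallel>\<^bsub>lp_dual G T L p\<^esub> = 1"
    using infsumI[OF lp_sum] by (simp add: lp_dual_def)
  ultimately show ?thesis using that by blast
qed

text \<open>
  The unit circle meets the circle of radius \<open>\<epsilon>\<close> about \<open>1\<close> at the points with real part
  \<open>1 - \<epsilon>\<^sup>2 / 2\<close>; \<open>\<zeta>\<close> is one in the closed upper half plane.
\<close>

lemma unimodular_at_distance: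
  assumes "0 \<le> \<epsilon>" "\<epsilon> \<le> 2"
  obtains \<zeta> where "cmod \<zeta> = 1" "cmod (1 - \<zeta>) = \<epsilon>"
proof -
  define s where "s = 1 - \<epsilon>\<^sup>2 / 4"
  define \<zeta> where "\<zeta> = Complex (1 - \<epsilon>\<^sup>2 / 2) (\<epsilon> * sqrt s)"
  have "\<epsilon>\<^sup>2 \<le> 2\<^sup>2" using assms by (intro power_mono) auto
  then have s: "(sqrt s)\<^sup>2 = s" by (simp add: s_def)
  have "(1 - \<epsilon>\<^sup>2 / 2)\<^sup>2 + \<epsilon>\<^sup>2 * s = 1" and "(\<epsilon>\<^sup>2 / 2)\<^sup>2 + \<epsilon>\<^sup>2 * s = \<epsilon>\<^sup>2"
    by (simp_all add: s_def power2_eq_square algebra_simps)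
  then have "(cmod \<zeta>)\<^sup>2 = 1\<^sup>2" and "(cmod (1 - \<zeta>))\<^sup>2 = \<epsilon>\<^sup>2"
    unfolding cmod_power2 \<zeta>_def by (simp_all add: power_mult_distrib s)
  then have "cmod \<zeta> = 1" and "cmod (1 - \<zeta>) = \<epsilon>"
    using assms by (simp_all only: power2_eq_iff_nonneg norm_ge_zero zero_le_one)
  then show ?thesis using that by blast
qed

section \<open>Uniform convexity and uniform smoothness\<close>

lemma lp_dual_uniformly_convex:
  assumes p: "1 < p"
  shows "uniformly_convex (lp_dual G T L p)"
  unfolding uniformly_convex_def
proof (intro allI impI, elim conjE)
  fix \<epsilon> :: real
  assume \<epsilon>: "0 < \<epsilon>" "\<epsilon> \<le> 2"
  let ?X = "lp_dual G T L p" and ?\<Gamma> = "unitary_dual G T"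
  have p0: "0 < p" using p by simp
  obtain \<delta> where \<delta>: "0 < \<delta>" and convex:
    "\<And>(I :: ('a \<Rightarrow> complex mat) set set) w (u :: _ \<Rightarrow> complex) v.
      \<lbrakk>\<And>i. i \<in> I \<Longrightarrow> 0 \<le> w i;
       (\<lambda>i. w i * norm (u i) powr p) summable_on I; (\<lambda>i. w i * norm (v i) powr p) summable_on I;
       (\<Sum>\<^sub>\<infinity>i\<in>I. w i * norm (u i) powr p) = 1; (\<Sum>\<^sub>\<infinity>i\<in>I. w i * norm (v i) powr p) = 1;
       (\<Sum>\<^sub>\<infinity>i\<in>I. w i * norm (u i - v i) powr p) = \<epsilon> powr p\<rbrakk>
      \<Longrightarrow> (\<Sum>\<^sub>\<infinity>i\<in>I. w i * norm ((1 / 2) *\<^sub>R (u i + v i)) powr p) \<le> 1 - \<delta>"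
  proof (rule weighted_powr_uniformly_convex[OF p \<epsilon>(1),
        where ?'a = complex and ?'i = "('a \<Rightarrow> complex mat) set"], goal_cases)
    case (1 \<delta>)
    from 1(1)[OF 1(2,3)] show ?case .
  qed
  let ?S = "{1 - \<parallel>(1 / 2) \<odot>\<^bsub>?X\<^esub> (x \<oplus>\<^bsub>?X\<^esub> y)\<parallel>\<^bsub>?X\<^esub> | x y.
     x \<in> carrier ?X \<and> y \<in> carrier ?X \<and> \<parallel>x\<parallel>\<^bsub>?X\<^esub> = 1 \<and> \<parallel>y\<parallel>\<^bsub>?X\<^esub> = 1 \<and> \<parallel>x \<ominus>\<^bsub>?X\<^esub> y\<parallel>\<^bsub>?X\<^esub> = \<epsilon>}"
  \<comment> \<open>The infimum of the empty set of reals is unspecified, so a unit pair at distance \<open>\<epsilon>\<close> is needed.\<close>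
  have "?S \<noteq> {}"
  proof -
    obtain e where e: "e \<in> carrier ?X" "\<parallel>e\<parallel>\<^bsub>?X\<^esub> = 1"
      using lp_dual_unit_vector[OF p0] .
    obtain \<zeta> where \<zeta>: "cmod \<zeta> = 1" "cmod (1 - \<zeta>) = \<epsilon>"
      using unimodular_at_distance \<epsilon> by (metis less_imp_le)
    have \<zeta>e: "\<zeta> \<odot>\<^bsub>?X\<^esub> e \<in> carrier ?X" "\<parallel>\<zeta> \<odot>\<^bsub>?X\<^esub> e\<parallel>\<^bsub>?X\<^esub> = 1"
      using lp_dual_smult[OF e(1) p0, of \<zeta>] e \<zeta> by auto
    have "e c + (- 1) \<cdot>\<^sub>m (\<zeta> \<cdot>\<^sub>m e c) = (1 - \<zeta>) \<cdot>\<^sub>m e c" if "c \<in> ?\<Gamma>" for c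
      using lp_dual_value[OF e(1) that] by (intro eq_matI) (auto simp: algebra_simps)
    then have "e \<ominus>\<^bsub>?X\<^esub> (\<zeta> \<odot>\<^bsub>?X\<^esub> e) = (1 - \<zeta>) \<odot>\<^bsub>?X\<^esub> e"
      unfolding lp_dual_minus[OF \<zeta>e(1) p0] by (auto simp: lp_dual_def intro!: restrict_ext)
    then have "\<parallel>e \<ominus>\<^bsub>?X\<^esub> (\<zeta> \<odot>\<^bsub>?X\<^esub> e)\<parallel>\<^bsub>?X\<^esub> = \<epsilon>"
      using lp_dual_smult(2)[OF e(1) p0] e \<zeta> by simp
    then show ?thesis using e \<zeta>e by blast
  qed
  moreover have "\<delta> / p \<le> s" if mem: "s \<in> ?S" for s
  proof -
    obtain x y where s: "s = 1 - \<parallel>(1 / 2) \<odot>\<^bsub>?X\<^esub> (x \<oplus>\<^bsub>?X\<^esub> y)\<parallel>\<^bsub>?X\<^esub>"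
      and x: "x \<in> carrier ?X" "\<parallel>x\<parallel>\<^bsub>?X\<^esub> = 1" and y: "y \<in> carrier ?X" "\<parallel>y\<parallel>\<^bsub>?X\<^esub> = 1"
      and dist: "\<parallel>x \<ominus>\<^bsub>?X\<^esub> y\<parallel>\<^bsub>?X\<^esub> = \<epsilon>"
      using mem by blast
    obtain u v :: "('a \<Rightarrow> complex mat) set \<Rightarrow> complex" where
      "(\<lambda>c. lp_weight G p c * norm (u c) powr p) summable_on ?\<Gamma>"
      "(\<lambda>c. lp_weight G p c * norm (v c) powr p) summable_on ?\<Gamma>"
      "\<parallel>x\<parallel>\<^bsub>?X\<^esub> powr p = (\<Sum>\<^sub>\<infinity>c\<in>?\<Gamma>. lp_weight G p c * norm (u c) powr p)"
      "\<parallel>y\<parallel>\<^bsub>?X\<^esub> powr p = (\<Sum>\<^sub>\<infinity>c\<in>?\<Gamma>. lp_weight G p c * norm (v c) powr p)"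
      "\<parallel>x \<ominus>\<^bsub>?X\<^esub> y\<parallel>\<^bsub>?X\<^esub> powr p = (\<Sum>\<^sub>\<infinity>c\<in>?\<Gamma>. lp_weight G p c * norm (u c - v c) powr p)"
      and mid: "\<parallel>(1 / 2) \<odot>\<^bsub>?X\<^esub> (x \<oplus>\<^bsub>?X\<^esub> y)\<parallel>\<^bsub>?X\<^esub> powr p
        = (\<Sum>\<^sub>\<infinity>c\<in>?\<Gamma>. lp_weight G p c * norm ((1 / 2) *\<^sub>R (u c + v c)) powr p)"
      \<comment> \<open>The parameter \<open>t\<close> enters only the norms of \<open>x + t y\<close> and \<open>x - t y\<close>, so any value will do.\<close>
      by (rule lp_dual_pair_complex_realization[OF p0 x(1) y(1), where t = 0]) (rule that; assumption)
    then have "\<parallel>(1 / 2) \<odot>\<^bsub>?X\<^esub> (x \<oplus>\<^bsub>?X\<^esub> y)\<parallel>\<^bsub>?X\<^esub> powr p \<le> 1 - \<delta>"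
      unfolding mid using x(2) y(2) dist by (intro convex lp_weight_nonneg) simp_all
    then have "p * (\<parallel>(1 / 2) \<odot>\<^bsub>?X\<^esub> (x \<oplus>\<^bsub>?X\<^esub> y)\<parallel>\<^bsub>?X\<^esub> - 1) \<le> - \<delta>"
      using powr_ge_Bernoulli[OF p lp_dual_vnorm_nonneg, of G T L p "(1 / 2) \<odot>\<^bsub>?X\<^esub> (x \<oplus>\<^bsub>?X\<^esub> y)"]
      by linarith
    then show ?thesis using p by (simp add: s field_simps)
  qed
  ultimately have "\<delta> / p \<le> modulus_of_convexity ?X \<epsilon>"
    unfolding modulus_of_convexity_def by (rule cInf_greatest)
  moreover have "0 < \<delta> / p" using \<delta> p by simp
  ultimately show "0 < modulus_of_convexity ?X \<epsilon>" by linarith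
qed

lemma lp_dual_uniformly_smooth:
  assumes p: "1 < p"
  shows "uniformly_smooth (lp_dual G T L p)"
  unfolding uniformly_smooth_def
proof (rule tendstoI)
  fix \<eta> :: real
  assume \<eta>: "0 < \<eta>"
  let ?X = "lp_dual G T L p" and ?\<Gamma> = "unitary_dual G T"
  have p0: "0 < p" using p by simp
  obtain \<tau> where \<tau>: "0 < \<tau>" and smooth:
    "\<And>t (I :: ('a \<Rightarrow> complex mat) set set) w (u :: _ \<Rightarrow> complex) v.
      \<lbrakk>0 \<le> t; t \<le> \<tau>; \<And>i. i \<in> I \<Longrightarrow> 0 \<le> w i;
       (\<lambda>i. w i * norm (u i) powr p) summable_on I; (\<lambda>i. w i * norm (v i) powr p) summable_on I;
       (\<Sum>\<^sub>\<infinity>i\<in>I. w i * norm (u i) powr p) = 1; (\<Sum>\<^sub>\<infinity>i\<in>I. w i * norm (v i) powr p) = 1\<rbrakk>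
      \<Longrightarrow> (\<Sum>\<^sub>\<infinity>i\<in>I. w i * norm (u i + t *\<^sub>R v i) powr p)
          + (\<Sum>\<^sub>\<infinity>i\<in>I. w i * norm (u i - t *\<^sub>R v i) powr p) \<le> 2 + \<eta> * t"
  proof (rule weighted_powr_uniformly_smooth[OF p \<eta>,
        where ?'a = complex and ?'i = "('a \<Rightarrow> complex mat) set"], goal_cases)
    case (1 \<tau>)
    from 1(1)[OF 1(2,3)] show ?case .
  qed
  have "dist (modulus_of_smoothness ?X t / t) 0 < \<eta>" if t: "0 < t" "t < min 1 \<tau>" for t
  proof -
    let ?S = "{(\<parallel>x \<oplus>\<^bsub>?X\<^esub> complex_of_real t \<odot>\<^bsub>?X\<^esub> y\<parallel>\<^bsub>?X\<^esub>
            + \<parallel>x \<ominus>\<^bsub>?X\<^esub> complex_of_real t \<odot>\<^bsub>?X\<^esub> y\<parallel>\<^bsub>?X\<^esub>) / 2 - 1 | x y.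
        x \<in> carrier ?X \<and> y \<in> carrier ?X \<and> \<parallel>x\<parallel>\<^bsub>?X\<^esub> = 1 \<and> \<parallel>y\<parallel>\<^bsub>?X\<^esub> = 1}"
    have upper: "s \<le> \<eta> * t / (2 * p)" if mem: "s \<in> ?S" for s
    proof -
      obtain x y where x: "x \<in> carrier ?X" "\<parallel>x\<parallel>\<^bsub>?X\<^esub> = 1" and y: "y \<in> carrier ?X" "\<parallel>y\<parallel>\<^bsub>?X\<^esub> = 1"
        and s: "s = (\<parallel>x \<oplus>\<^bsub>?X\<^esub> complex_of_real t \<odot>\<^bsub>?X\<^esub> y\<parallel>\<^bsub>?X\<^esub>
            + \<parallel>x \<ominus>\<^bsub>?X\<^esub> complex_of_real t \<odot>\<^bsub>?X\<^esub> y\<parallel>\<^bsub>?X\<^esub>) / 2 - 1"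
        using mem by blast
      let ?P = "x \<oplus>\<^bsub>?X\<^esub> complex_of_real t \<odot>\<^bsub>?X\<^esub> y" and ?M = "x \<ominus>\<^bsub>?X\<^esub> complex_of_real t \<odot>\<^bsub>?X\<^esub> y"
      obtain u v :: "('a \<Rightarrow> complex mat) set \<Rightarrow> complex" where
        "(\<lambda>c. lp_weight G p c * norm (u c) powr p) summable_on ?\<Gamma>"
        "(\<lambda>c. lp_weight G p c * norm (v c) powr p) summable_on ?\<Gamma>"
        "\<parallel>x\<parallel>\<^bsub>?X\<^esub> powr p = (\<Sum>\<^sub>\<infinity>c\<in>?\<Gamma>. lp_weight G p c * norm (u c) powr p)"
        "\<parallel>y\<parallel>\<^bsub>?X\<^esub> powr p = (\<Sum>\<^sub>\<infinity>c\<in>?\<Gamma>. lp_weight G p c * norm (v c) powr p)"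
        and plus: "\<parallel>x \<oplus>\<^bsub>?X\<^esub> complex_of_real t \<odot>\<^bsub>?X\<^esub> y\<parallel>\<^bsub>?X\<^esub> powr p
          = (\<Sum>\<^sub>\<infinity>c\<in>?\<Gamma>. lp_weight G p c * norm (u c + t *\<^sub>R v c) powr p)"
        and minus: "\<parallel>x \<ominus>\<^bsub>?X\<^esub> complex_of_real t \<odot>\<^bsub>?X\<^esub> y\<parallel>\<^bsub>?X\<^esub> powr p
          = (\<Sum>\<^sub>\<infinity>c\<in>?\<Gamma>. lp_weight G p c * norm (u c - t *\<^sub>R v c) powr p)"
        by (rule lp_dual_pair_complex_realization[OF p0 x(1) y(1), where t = t]) (rule that; assumption)
      then have "\<parallel>?P\<parallel>\<^bsub>?X\<^esub> powr p + \<parallel>?M\<parallel>\<^bsub>?X\<^esub> powr p \<le> 2 + \<eta> * t"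
        unfolding plus minus using x(2) y(2) t by (intro smooth lp_weight_nonneg) simp_all
      then have "p * (\<parallel>?P\<parallel>\<^bsub>?X\<^esub> - 1) + p * (\<parallel>?M\<parallel>\<^bsub>?X\<^esub> - 1) \<le> \<eta> * t"
        using powr_ge_Bernoulli[OF p lp_dual_vnorm_nonneg, of G T L p ?P]
          powr_ge_Bernoulli[OF p lp_dual_vnorm_nonneg, of G T L p ?M] by linarith
      then show ?thesis using p unfolding s by (simp add: field_simps)
    qed
    \<comment> \<open>The pair \<open>(e, e)\<close> has the norms \<open>1 + t\<close> and \<open>1 - t\<close>, as \<open>t \<le> 1\<close>; so the supremum is nonnegative.\<close>
    have "0 \<in> ?S"
    proof -
      obtain e where e: "e \<in> carrier ?X" "\<parallel>e\<parallel>\<^bsub>?X\<^esub> = 1"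
        using lp_dual_unit_vector[OF p0] .
      have te: "complex_of_real t \<odot>\<^bsub>?X\<^esub> e \<in> carrier ?X" by (rule lp_dual_smult(1)[OF e(1) p0])
      have "e c + complex_of_real t \<cdot>\<^sub>m e c = complex_of_real (1 + t) \<cdot>\<^sub>m e c"
        "e c + (- 1) \<cdot>\<^sub>m (complex_of_real t \<cdot>\<^sub>m e c) = complex_of_real (1 - t) \<cdot>\<^sub>m e c"
        if "c \<in> ?\<Gamma>" for c
        using lp_dual_value[OF e(1) that] by (auto intro!: eq_matI simp: algebra_simps)
      then have "e \<oplus>\<^bsub>?X\<^esub> complex_of_real t \<odot>\<^bsub>?X\<^esub> e = complex_of_real (1 + t) \<odot>\<^bsub>?X\<^esub> e"
        "e \<ominus>\<^bsub>?X\<^esub> complex_of_real t \<odot>\<^bsub>?X\<^esub> e = complex_of_real (1 - t) \<odot>\<^bsub>?X\<^esub> e"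
        unfolding lp_dual_minus[OF te p0] by (auto simp: lp_dual_def intro!: restrict_ext)
      then have "\<parallel>e \<oplus>\<^bsub>?X\<^esub> complex_of_real t \<odot>\<^bsub>?X\<^esub> e\<parallel>\<^bsub>?X\<^esub> = 1 + t"
        "\<parallel>e \<ominus>\<^bsub>?X\<^esub> complex_of_real t \<odot>\<^bsub>?X\<^esub> e\<parallel>\<^bsub>?X\<^esub> = 1 - t"
        using lp_dual_smult(2)[OF e(1) p0] e(2) t by (simp_all del: of_real_add of_real_diff)
      then have "0 = (\<parallel>e \<oplus>\<^bsub>?X\<^esub> complex_of_real t \<odot>\<^bsub>?X\<^esub> e\<parallel>\<^bsub>?X\<^esub>
            + \<parallel>e \<ominus>\<^bsub>?X\<^esub> complex_of_real t \<odot>\<^bsub>?X\<^esub> e\<parallel>\<^bsub>?X\<^esub>) / 2 - 1" by simp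
      then show ?thesis using e by blast
    qed
    then have "0 \<le> modulus_of_smoothness ?X t"
      unfolding modulus_of_smoothness_def using upper
      by (intro cSup_upper bdd_aboveI) auto
    moreover have "modulus_of_smoothness ?X t \<le> \<eta> * t / (2 * p)"
      unfolding modulus_of_smoothness_def using upper \<open>0 \<in> ?S\<close>
      by (intro cSup_least) auto
    moreover have "\<eta> * t / (2 * p) < \<eta> * t"
      using \<eta> t p by (simp add: field_simps)
    ultimately show ?thesis using t by (simp add: field_simps)
  qed
  then show "eventually (\<lambda>t. dist (modulus_of_smoothness ?X t / t) 0 < \<eta>) (at_right 0)"
    using \<tau> unfolding eventually_at_right_field by (intro exI[of _ "min 1 \<tau>"]) auto
qed

(* The facts on which the two halves of the theorem rest. *)
thm_deps lp_dual_uniformly_convex lp_dual_uniformly_smooth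

theorem theorem4p1:
  fixes G :: "('g, 'm) monoid_scheme"
    and T :: "'g topology"
    and D :: "('g \<Rightarrow> complex) set"
    and L :: "('g \<Rightarrow> complex) \<Rightarrow> 'g \<Rightarrow> complex"
    and p :: real
  assumes "compact_group G T"
    and "positive_laplacian G T D L"
    and "1 < p"
  shows "uniformly_convex (lp_dual G T L p) \<and> uniformly_smooth (lp_dual G T L p)"
  by (intro conjI lp_dual_uniformly_convex lp_dual_uniformly_smooth assms(3))

end
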